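(* Consider the nonlinear system and the residual-aware DR-EKF described in the context, with estimates $\bar x_t^-,\bar x_t$, Jacobians $A_t,C_t$, gains $K_t^*$, and true prior and posterior errors $e_t^-=x_t-\bar x_t^-$, $e_t=x_t-\bar x_t$. Suppose the following. (A1) There are constants $L_f,L_h\ge 0$ and an open set $\mathcal N\subset\mathbb R^{n_x}$ (a neighborhood of the filter trajectory) such that $\frac{\partial f}{\partial x}(\cdot,u)$ is $L_f$-Lipschitz on $\mathcal N$ uniformly over admissible inputs $u$, $\frac{\partial h}{\partial x}$ is $L_h$-Lipschitz on $\mathcal N$, and almost surely, for all $t\ge 0$, the line segments joining $\bar x_t^-$ to $x_t$ and $\bar x_t$ to $x_t$ lie in $\mathcal N$. (A2) There are constants $\alpha_f,\alpha_h\ge 0$ with $(\mathbb E[\|e_t^-\|^4])^{1/2}\le \alpha_h\mathbb E[\|e_t^-\|^2]$ for all $t\ge 0$ and $(\mathbb E[\|e_{t-1}\|^4])^{1/2}\le \alpha_f\mathbb E[\|e_{t-1}\|^2]$ for all $t\ge 1$. (A3) For each $t\ge 0$, $\theta_{\epsilon,t}\ge 0$ satisfies $W_2(\mathcal L(\epsilon_t),\hat{\mathbb Q}_{\epsilon,t})\le\theta_{\epsilon,t}$. (A4) There are deterministic sequences $\{\bar a_t,\bar m_t,\bar k_t\}_{t\ge 0}$ such that, for every $t\ge 0$, $\|A_t\|\le\bar a_t$, $\|I-K_t^*C_t\|\le\bar m_t$ and $\|K_t^*\|\le\bar k_t$ almost surely. Define deterministic sequences recursively by $\rho_0^-:=0$,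 $\bar\eta^f_{-1}:=0$, $$\bar s_0:=\bar m_0\sqrt{\operatorname{Tr}(\hat\Sigma_{x,0}^-)}+\bar k_0\sqrt{\operatorname{Tr}(\hat\Sigma_{v,0})}+(\bar m_0+\bar k_0)\theta_{\epsilon,0},\qquad \gamma_0:=\sqrt{\operatorname{Tr}(\hat\Sigma_{x,0}^-)}+\theta_{\epsilon,0},$$ and, for $t\ge 1$, $$\bar s_t:=\bar m_t\Bigl(\bar a_{t-1}\bar s_{t-1}+\sqrt{\operatorname{Tr}(\hat\Sigma_{w,t-1})}\Bigr)+\bar k_t\sqrt{\operatorname{Tr}(\hat\Sigma_{v,t})}+(\bar m_t+\bar k_t)\theta_{\epsilon,t},$$ $$\gamma_t:=\bar a_{t-1}\bar V_{t-1}+\sqrt{\operatorname{Tr}(\hat\Sigma_{w,t-1})}+\theta_{\epsilon,t}+\bar\eta^f_{t-1},$$ and, for $t\ge 0$, $$\bar\eta^h_t:=\tfrac{L_h}{2}\alpha_h\gamma_t^2,\qquad \bar\theta^{\mathrm{eff}}_{\epsilon,t}:=\theta_{\epsilon,t}+\sqrt{(\bar\eta^f_{t-1})^2+(\bar\eta^h_t)^2},\qquad \rho_t:=\bar m_t\rho_t^-+\bar k_t\bar\eta^h_t,$$ $$\bar V_t:=\bar s_t+\rho_t,\qquad \bar\eta^f_t:=\tfrac{L_f}{2}\alpha_f\bar V_t^2,\qquad \rho_{t+1}^-:=\bar a_t\rho_t+\bar\eta_t^f .$$ Suppose the filter at stage $t$ uses the radius $\theta_t=\bar\theta^{\mathrm{eff}}_{\epsilon,t}$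 in the semidefinite program defining $K_t^*$. Then, for every $t\ge 0$: (i) the law of the effective uncertainty $\tilde\epsilon_t$ satisfies $W_2(\mathcal L(\tilde\epsilon_t),\hat{\mathbb Q}_{\epsilon,t})\le\bar\theta^{\mathrm{eff}}_{\epsilon,t}$; (ii) $\mathbb E[\|e_t^-\|^2]\le\gamma_t^2$; (iii) $\mathbb E[\|e_t\|^2]\le\bar V_t^2$.
   Context: Notation. $\|\cdot\|$ is the Euclidean norm for vectors and the spectral norm for matrices; $\mathcal L(z)$ is the law of $z$; $W_2$ is the type-2 Wasserstein distance with Euclidean cost on probability measures with finite second moment; $\mathbb S^n_+$ is the set of symmetric PSD $n\times n$ matrices. System. For $t\ge 0$, $x_{t+1}=f(x_t,u_t)+w_t$, $y_t=h(x_t)+v_t$, with $f:\mathbb R^{n_x}\times\mathbb R^{n_u}\to\mathbb R^{n_x}$, $h:\mathbb R^{n_x}\to\mathbb R^{n_y}$ twice continuously differentiable and $u_t$ a known input. The random vectors $x_0,w_t\in\mathbb R^{n_x}$, $v_t\in\mathbb R^{n_y}$ have finite second moments; $x_0,\{w_t\},\{v_t\}$ are mutually independent, and $\{w_t\}$ and $\{v_t\}$ are each temporally independent. $\mathcal Y_t=\sigma(y_0,\dots,y_t)$, $\mathcal Y_{-1}$ trivial; $u_t$ is $\mathcal Y_t$-measurable. Nominal model. $\hat x_0^-,\hat w_t,\hat v_t$ are given vectors and $\hat\Sigma_{x,0}^-,\hat\Sigma_{w,t},\hat\Sigma_{v,t}$ given positive definite matrices. The stacked noise is $\epsilon_0=[x_0^\top,v_0^\top]^\top$,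 $\epsilon_t=[w_{t-1}^\top,v_t^\top]^\top$ for $t\ge1$. Its nominal law is $\hat{\mathbb Q}_{\epsilon,t}=\mathcal N(\hat\epsilon_t,\hat\Sigma_{\epsilon,t})$ with $\hat\epsilon_0=[(\hat x_0^-)^\top,\hat v_0^\top]^\top$, $\hat\Sigma_{\epsilon,0}=\operatorname{diag}(\hat\Sigma_{x,0}^-,\hat\Sigma_{v,0})$, and for $t\ge1$, $\hat\epsilon_t=[\hat w_{t-1}^\top,\hat v_t^\top]^\top$, $\hat\Sigma_{\epsilon,t}=\operatorname{diag}(\hat\Sigma_{w,t-1},\hat\Sigma_{v,t})$. Filter. $\bar x_0^-=\hat x_0^-$; for $t\ge 0$: $C_t=\frac{\partial h}{\partial x}(\bar x_t^-)$, $\bar x_t=\bar x_t^-+K_t^*\bigl(y_t-h(\bar x_t^-)-\hat v_t\bigr)$, $A_t=\frac{\partial f}{\partial x}(\bar x_t,u_t)$, $\bar x_{t+1}^-=f(\bar x_t,u_t)+\hat w_t$. The gain is $K_t^*=T_t^*(S_t^* )^{-1}$, where $T_t^*,S_t^*$ come from a ($\mathcal Y_{t-1}$-measurably chosen) optimal solution of the following semidefinite program with radius $\theta_t\ge 0$; the optimal $\Sigma_{x,t}$ is carried to the next stage as the posterior covariance. For $t\ge 1$: maximize $\operatorname{Tr}(\Sigma_{x,t})$ over $\Sigma_{x,t}^-,\Sigma_{x,t},\Sigma_{w,t-1}\in\mathbb S^{n_x}_+$, $\Sigma_{v,t}\in\mathbb S^{n_y}_+$, $\Sigma_{wv,t-1}\in\mathbb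 R^{n_x\times n_y}$, $Z_t\in\mathbb R^{(n_x+n_y)\times(n_x+n_y)}$ subject to $\Sigma_{x,t}^-=A_{t-1}\Sigma_{x,t-1}A_{t-1}^\top+\Sigma_{w,t-1}$, $\begin{bmatrix} \Sigma_{x,t}^- - \Sigma_{x,t} & T_t \\ T_t^\top & S_t \end{bmatrix}\succeq0$, $\begin{bmatrix} \hat\Sigma_{\epsilon,t} & Z_t \\ Z_t^\top & \Sigma_{\epsilon,t} \end{bmatrix}\succeq0$, $\operatorname{Tr}(\Sigma_{\epsilon,t}+\hat\Sigma_{\epsilon,t}-2Z_t)\le\theta_t^2$, $\Sigma_{\epsilon,t}\succeq\lambda_{\min}(\hat\Sigma_{\epsilon,t})I$, $\Sigma_{\epsilon,t}=\begin{bmatrix} \Sigma_{w,t-1} & \Sigma_{wv,t-1} \\ \Sigma_{wv,t-1}^\top & \Sigma_{v,t} \end{bmatrix}\succeq 0$, where $T_t=\Sigma_{x,t}^-C_t^\top+\Sigma_{wv,t-1}$ and $S_t=C_t\Sigma_{x,t}^-C_t^\top+\Sigma_{v,t}+C_t\Sigma_{wv,t-1}+\Sigma_{wv,t-1}^\top C_t^\top$. For $t=0$ the same program is used without the first (propagation) constraint, with $\Sigma_{w,t-1}$ replaced by the free variable $\Sigma_{x,0}^-$ and $\Sigma_{wv,t-1}$ replaced by $\Sigma_{xv,0}\in\mathbb R^{n_x\times n_y}$. Residuals and effective uncertainty. $r^f_{t-1}(e)=f(\bar x_{t-1}+e,u_{t-1})-f(\bar x_{t-1},u_{t-1})-A_{t-1}e$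 and $r^h_t(e)=h(\bar x_t^-+e)-h(\bar x_t^-)-C_te$. Set $\tilde w_{t-1}=w_{t-1}+r^f_{t-1}(e_{t-1})$, $\tilde v_t=v_t+r^h_t(e_t^-)$, and $\tilde\epsilon_0=[x_0^\top,\tilde v_0^\top]^\top$, $\tilde\epsilon_t=[\tilde w_{t-1}^\top,\tilde v_t^\top]^\top$ for $t\ge1$. *)

theory Defs
  imports "HOL-Probability.Probability"
begin

section \<open>Matrices\<close>

definition psd :: "real^'k^'k \<Rightarrow> bool" where
  "psd A \<longleftrightarrow> transpose A = A \<and> (\<forall>z. 0 \<le> z \<bullet> (A *v z))"

definition pos_def :: "real^'k^'k \<Rightarrow> bool" where
  "pos_def A \<longleftrightarrow> transpose A = A \<and> (\<forall>z. z \<noteq> 0 \<longrightarrow> 0 < z \<bullet> (A *v z))"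

(* norm on real^'k^'l is the Frobenius norm, so the spectral norm is taken as an operator norm *)
definition spectral_norm :: "real^'k^'l \<Rightarrow> real" where
  "spectral_norm A = onorm (\<lambda>z. A *v z)"

(* only used for symmetric A, where the set of eigenvalues is finite and nonempty *)
definition lambda_min :: "real^'k^'k \<Rightarrow> real" where
  "lambda_min A = Min {l. \<exists>z. z \<noteq> 0 \<and> A *v z = l *\<^sub>R z}"

definition stack :: "real^'a \<Rightarrow> real^'b \<Rightarrow> real^('a + 'b)" where
  "stack p q = (\<chi> i. case i of Inl a \<Rightarrow> p $ a | Inr b \<Rightarrow> q $ b)"

(* the matrix with block rows [A, B] and [C, D] *)
definition block_matrix ::
  "real^'a^'c \<Rightarrow> real^'b^'c \<Rightarrow> real^'a^'d \<Rightarrow> real^'b^'d \<Rightarrow> real^('a + 'b)^('c + 'd)" where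
  "block_matrix A B C D = (\<chi> i j. case i of
      Inl c \<Rightarrow> (case j of Inl a \<Rightarrow> A $ c $ a | Inr b \<Rightarrow> B $ c $ b)
    | Inr d \<Rightarrow> (case j of Inl a \<Rightarrow> C $ d $ a | Inr b \<Rightarrow> D $ d $ b))"

definition block_diag :: "real^'a^'a \<Rightarrow> real^'b^'b \<Rightarrow> real^('a + 'b)^('a + 'b)" where
  "block_diag A D = block_matrix A 0 0 D"

section \<open>Smoothness and linearization residuals\<close>

definition twice_continuously_differentiable ::
  "('a::euclidean_space \<Rightarrow> 'b::euclidean_space) \<Rightarrow> bool" where
  "twice_continuously_differentiable g \<longleftrightarrow>
     (\<exists>(g' :: 'a \<Rightarrow> 'a \<Rightarrow>\<^sub>L 'b) (g'' :: 'a \<Rightarrow> 'a \<Rightarrow>\<^sub>L ('a \<Rightarrow>\<^sub>L 'b)).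
        (\<forall>z. (g has_derivative blinfun_apply (g' z)) (at z)) \<and>
        (\<forall>z. (g' has_derivative blinfun_apply (g'' z)) (at z)) \<and>
        continuous_on UNIV g'')"

definition residual :: "(real^'k \<Rightarrow> real^'l) \<Rightarrow> real^'k \<Rightarrow> real^'k \<Rightarrow> real^'l" where
  "residual g c e = g (c + e) - g c - jacobian g (at c) *v e"

section \<open>Probability\<close>

definition generated_algebra ::
  "'w measure \<Rightarrow> ('i \<Rightarrow> 'w \<Rightarrow> 'a::topological_space) \<Rightarrow> 'i set \<Rightarrow> 'w measure" where
  "generated_algebra M X I =
     sigma (space M) {X i -` B \<inter> space M | i B. i \<in> I \<and> B \<in> sets borel}"

(* N(mu, S) for positive definite S *)
definition gaussian :: "real^'k \<Rightarrow> real^'k^'k \<Rightarrow> (real^'k) measure" where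
  "gaussian \<mu> S = density lborel (\<lambda>z. ennreal
     (exp (- ((z - \<mu>) \<bullet> (matrix_inv S *v (z - \<mu>))) / 2) / sqrt ((2 * pi) ^ CARD('k) * det S)))"

definition esqrt :: "ennreal \<Rightarrow> ennreal" where
  "esqrt a = (if a = \<infinity> then \<infinity> else ennreal (sqrt (enn2real a)))"

definition couplings ::
  "'a::euclidean_space measure \<Rightarrow> 'a measure \<Rightarrow> ('a \<times> 'a) measure set" where
  "couplings P Q = {\<pi>. sets \<pi> = sets (borel \<Otimes>\<^sub>M borel) \<and>
     distr \<pi> borel fst = P \<and> distr \<pi> borel snd = Q}"

(* Extended-valued: it is finite whenever P and Q are probability measures on the Borel sets
   with finite second moments, and a bound by a real number is never satisfied by convention. *)
definition W2 :: "'a::euclidean_space measure \<Rightarrow> 'a measure \<Rightarrow> ennreal" where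
  "W2 P Q = esqrt (INF \<pi>\<in>couplings P Q. \<integral>\<^sup>+ z. ennreal ((norm (fst z - snd z))\<^sup>2) \<partial>\<pi>)"

section \<open>The semidefinite program\<close>

(* For t >= 1, noise_cov and cross_cov are Sigma_{w,t-1} and Sigma_{wv,t-1};
   for t = 0 they are Sigma_{x,0}^- and Sigma_{xv,0}. *)
record ('n::finite, 'm::finite) sdp_point =
  prior_cov :: "real^'n^'n"
  post_cov :: "real^'n^'n"
  noise_cov :: "real^'n^'n"
  meas_cov :: "real^'m^'m"
  cross_cov :: "real^'m^'n"
  coupling_mat :: "real^('n + 'm)^('n + 'm)"

definition sdp_T :: "real^'n^'m \<Rightarrow> ('n::finite, 'm::finite) sdp_point \<Rightarrow> real^'m^'n" where
  "sdp_T C d = prior_cov d ** transpose C + cross_cov d"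

definition sdp_S :: "real^'n^'m \<Rightarrow> ('n::finite, 'm::finite) sdp_point \<Rightarrow> real^'m^'m" where
  "sdp_S C d = C ** prior_cov d ** transpose C + meas_cov d
     + C ** cross_cov d + transpose (cross_cov d) ** transpose C"

definition sdp_eps_cov :: "('n::finite, 'm::finite) sdp_point \<Rightarrow> real^('n + 'm)^('n + 'm)" where
  "sdp_eps_cov d =
     block_matrix (noise_cov d) (cross_cov d) (transpose (cross_cov d)) (meas_cov d)"

definition sdp_common_constraints ::
  "real^('n + 'm)^('n + 'm) \<Rightarrow> real^'n^'m \<Rightarrow> real \<Rightarrow> ('n::finite, 'm::finite) sdp_point \<Rightarrow> bool" where
  "sdp_common_constraints Sh C \<theta> d \<longleftrightarrow>
     psd (prior_cov d) \<and> psd (post_cov d) \<and> psd (noise_cov d) \<and> psd (meas_cov d) \<and>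
     psd (block_matrix (prior_cov d - post_cov d) (sdp_T C d)
            (transpose (sdp_T C d)) (sdp_S C d)) \<and>
     psd (block_matrix Sh (coupling_mat d) (transpose (coupling_mat d)) (sdp_eps_cov d)) \<and>
     trace (sdp_eps_cov d + Sh - 2 *\<^sub>R coupling_mat d) \<le> \<theta>\<^sup>2 \<and>
     psd (sdp_eps_cov d - lambda_min Sh *\<^sub>R mat 1) \<and>
     psd (sdp_eps_cov d)"

definition sdp_feasible_init ::
  "real^('n + 'm)^('n + 'm) \<Rightarrow> real^'n^'m \<Rightarrow> real \<Rightarrow> ('n::finite, 'm::finite) sdp_point \<Rightarrow> bool" where
  "sdp_feasible_init Sh C \<theta> d \<longleftrightarrow>
     sdp_common_constraints Sh C \<theta> d \<and> noise_cov d = prior_cov d"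

(* A and P are the Jacobian and the posterior covariance of the previous stage *)
definition sdp_feasible_step ::
  "real^'n^'n \<Rightarrow> real^'n^'n \<Rightarrow> real^('n + 'm)^('n + 'm) \<Rightarrow> real^'n^'m \<Rightarrow> real \<Rightarrow>
     ('n::finite, 'm::finite) sdp_point \<Rightarrow> bool" where
  "sdp_feasible_step A P Sh C \<theta> d \<longleftrightarrow>
     sdp_common_constraints Sh C \<theta> d \<and> prior_cov d = A ** P ** transpose A + noise_cov d"

definition sdp_optimal :: "(('n::finite, 'm::finite) sdp_point \<Rightarrow> bool) \<Rightarrow> ('n, 'm) sdp_point \<Rightarrow> bool" where
  "sdp_optimal feas d \<longleftrightarrow>
     feas d \<and> (\<forall>d'. feas d' \<longrightarrow> trace (post_cov d') \<le> trace (post_cov d))"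

definition sdp_measurable ::
  "'w measure \<Rightarrow> ('w \<Rightarrow> ('n::finite, 'm::finite) sdp_point) \<Rightarrow> bool" where
  "sdp_measurable F D \<longleftrightarrow>
     (\<lambda>\<omega>. prior_cov (D \<omega>)) \<in> borel_measurable F \<and>
     (\<lambda>\<omega>. post_cov (D \<omega>)) \<in> borel_measurable F \<and>
     (\<lambda>\<omega>. noise_cov (D \<omega>)) \<in> borel_measurable F \<and>
     (\<lambda>\<omega>. meas_cov (D \<omega>)) \<in> borel_measurable F \<and>
     (\<lambda>\<omega>. cross_cov (D \<omega>)) \<in> borel_measurable F \<and>
     (\<lambda>\<omega>. coupling_mat (D \<omega>)) \<in> borel_measurable F"

end

theory Submission
  imports Defs
begin

text \<open>The errors satisfy
  \<open>e\<^sub>t = (I - K\<^sub>t C\<^sub>t) e\<^sub>t\<^sup>- - K\<^sub>t (v\<^sub>t - vhat\<^sub>t) - K\<^sub>t r\<^sup>h\<^sub>t\<close> and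
  \<open>e\<^sub>t\<^sub>+\<^sub>1\<^sup>- = A\<^sub>t e\<^sub>t + (w\<^sub>t - what\<^sub>t) + r\<^sup>f\<^sub>t\<close>.
  By the Lipschitz bounds and the fourth moment condition, the residuals are at most
  \<open>L / 2 * \<alpha> * E |e|\<^sup>2\<close> in \<open>L\<^sup>2\<close>, and the Wasserstein bound puts the centred noises within \<open>\<theta>\<close>
  of centred Gaussians with known trace, so both moment bounds follow by alternating induction with
  Minkowski's inequality. The law of the effective noise differs from that of the true noise by the
  stacked residuals, so the Wasserstein bound follows from the triangle inequality. Since only
  an infimum over couplings is needed, couplings are glued approximately, along a countable
  partition into small cells, and no disintegration is required.\<close>

text \<open>Error bounds need residual bounds and conversely. The order of evaluation breaks the
  circle: \<open>\<gamma> t\<close> bounds the prior error, which yields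
  \<open>\<eta>\<^sub>h t\<close>, then \<open>V t\<close>, then \<open>\<eta>\<^sub>f t\<close>,
  then \<open>\<gamma> (Suc t)\<close>. The recursions keep a noise part \<open>s\<close> and a
  residual part \<open>\<rho>\<close> apart, whereas the induction works with their sum; the two
  agree because \<open>\<gamma> (Suc t)\<close> equals \<open>abar t * s t + sqrt (trace (Sw t)) +
  \<theta> (Suc t) + \<rho>_prior (Suc t)\<close>. Gains, errors and residuals are random and depend
  on each other, so contributions are added as norms and not as variances. Each noise block alone
  may lie at the full distance \<open>\<theta> t\<close> from its nominal law, which gives the term
  \<open>(mbar t + kbar t) * \<theta> t\<close> in \<open>s t\<close>. The two residuals enter
  \<open>\<theta>_eff t\<close> as components of one stacked vector, hence the square root of a sum
  of squares.\<close>

section \<open>Bounds in mean square\<close>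

text \<open>Stated with a nonnegative integral, so that no moment has to be known finite beforehand:
  finiteness of the error moments is itself a result of the induction. The condition
  \<open>0 \<le> c\<close> makes the bound on squares a bound on norms.\<close>

definition L2_le :: "'w measure \<Rightarrow> ('w \<Rightarrow> 'a::real_normed_vector) \<Rightarrow> real \<Rightarrow> bool" where
  "L2_le M g c \<longleftrightarrow> g \<in> borel_measurable M \<and> 0 \<le> c \<and>
     (\<integral>\<^sup>+ \<omega>. ennreal ((norm (g \<omega>))\<^sup>2) \<partial>M) \<le> ennreal (c\<^sup>2)"

text \<open>The gap is the perfect square \<open>(b * x - a * y)\<^sup>2 / (a * b)\<close>. The
  weights are chosen so that equality holds at \<open>x = a\<close>, \<open>y = b\<close>;
  integrating this inequality therefore gives Minkowski with the sharp constant
  \<open>(a + b)\<^sup>2\<close>.\<close>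

lemma weighted_square_sum:
  fixes x y a b :: real
  assumes "0 < a" "0 < b"
  shows "(x + y)\<^sup>2 \<le> (1 + b / a) * x\<^sup>2 + (1 + a / b) * y\<^sup>2"
proof -
  have "(1 + b / a) * x\<^sup>2 + (1 + a / b) * y\<^sup>2 - (x + y)\<^sup>2 = (b * x - a * y)\<^sup>2 / (a * b)"
    using assms by (simp add: field_simps power2_eq_square)
  also have "\<dots> \<ge> 0" using assms by simp
  finally show ?thesis by simp
qed

text \<open>Serves twice: to admit zero bounds in Minkowski's inequality, where the weights would
  divide by zero, and to pass from near-optimal couplings to the infimum.\<close>

lemma le_ennreal_square_of_add_epsilon:
  assumes "0 \<le> c" "\<And>\<delta>. 0 < \<delta> \<Longrightarrow> a \<le> ennreal ((c + \<delta>)\<^sup>2)"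
  shows "a \<le> ennreal (c\<^sup>2)"
proof -
  have "((\<lambda>\<delta>. ennreal ((c + \<delta>)\<^sup>2)) \<longlongrightarrow> ennreal ((c + 0)\<^sup>2)) (at_right 0)"
    by (intro tendsto_intros)
  moreover have "eventually (\<lambda>\<delta>. a \<le> ennreal ((c + \<delta>)\<^sup>2)) (at_right 0)"
    using assms(2) by (auto simp: eventually_at_right_field intro!: exI[of _ 1])
  ultimately show ?thesis
    using tendsto_lowerbound[of "\<lambda>\<delta>. ennreal ((c + \<delta>)\<^sup>2)" "ennreal ((c + 0)\<^sup>2)" "at_right 0" a]
    by simp
qed

lemma L2_le_triangle_pos:
  fixes f :: "'w \<Rightarrow> 'a::real_normed_vector" and g :: "'w \<Rightarrow> 'b::real_normed_vector"
    and k :: "'w \<Rightarrow> 'c::real_normed_vector"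
  assumes f: "L2_le M f a" and g: "L2_le M g b" and pos: "0 < a" "0 < b"
    and le: "AE \<omega> in M. norm (k \<omega>) \<le> norm (f \<omega>) + norm (g \<omega>)"
  shows "(\<integral>\<^sup>+ \<omega>. ennreal ((norm (k \<omega>))\<^sup>2) \<partial>M) \<le> ennreal ((a + b)\<^sup>2)"
proof -
  have [measurable]: "f \<in> borel_measurable M" "g \<in> borel_measurable M"
    using f g by (auto simp: L2_le_def)
  have "(\<integral>\<^sup>+ \<omega>. ennreal ((norm (k \<omega>))\<^sup>2) \<partial>M)
      \<le> (\<integral>\<^sup>+ \<omega>. ennreal (1 + b / a) * ennreal ((norm (f \<omega>))\<^sup>2)
             + ennreal (1 + a / b) * ennreal ((norm (g \<omega>))\<^sup>2) \<partial>M)"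
  proof (rule nn_integral_mono_AE)
    show "AE \<omega> in M. ennreal ((norm (k \<omega>))\<^sup>2) \<le> ennreal (1 + b / a) * ennreal ((norm (f \<omega>))\<^sup>2)
             + ennreal (1 + a / b) * ennreal ((norm (g \<omega>))\<^sup>2)"
      using le
    proof eventually_elim
      case (elim \<omega>)
      have "(norm (k \<omega>))\<^sup>2 \<le> (norm (f \<omega>) + norm (g \<omega>))\<^sup>2"
        using elim by (intro power_mono) auto
      also have "\<dots> \<le> (1 + b / a) * (norm (f \<omega>))\<^sup>2 + (1 + a / b) * (norm (g \<omega>))\<^sup>2"
        by (rule weighted_square_sum[OF pos])
      finally show ?case
        using pos by (simp flip: ennreal_mult ennreal_plus add: ennreal_leI)
    qed
  qed
  also have "\<dots> = ennreal (1 + b / a) * (\<integral>\<^sup>+ \<omega>. ennreal ((norm (f \<omega>))\<^sup>2) \<partial>M)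
      + ennreal (1 + a / b) * (\<integral>\<^sup>+ \<omega>. ennreal ((norm (g \<omega>))\<^sup>2) \<partial>M)"
    by (subst nn_integral_add) (auto simp: nn_integral_cmult)
  also have "\<dots> \<le> ennreal (1 + b / a) * ennreal (a\<^sup>2) + ennreal (1 + a / b) * ennreal (b\<^sup>2)"
    using f g by (intro add_mono mult_left_mono) (auto simp: L2_le_def)
  also have "\<dots> = ennreal ((1 + b / a) * a\<^sup>2 + (1 + a / b) * b\<^sup>2)"
    using pos by (simp flip: ennreal_mult ennreal_plus)
  also have "(1 + b / a) * a\<^sup>2 + (1 + a / b) * b\<^sup>2 = (a + b)\<^sup>2"
    using pos by (simp add: field_simps power2_eq_square)
  finally show ?thesis .
qed

lemma L2_le_mono:
  assumes "L2_le M f a" "a \<le> b"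
  shows "L2_le M f b"
  using assms unfolding L2_le_def
  by (auto intro!: order_trans[of _ "ennreal (a\<^sup>2)"] ennreal_leI power_mono)

lemma L2_le_triangle:
  fixes f :: "'w \<Rightarrow> 'a::real_normed_vector" and g :: "'w \<Rightarrow> 'b::real_normed_vector"
    and k :: "'w \<Rightarrow> 'c::real_normed_vector"
  assumes f: "L2_le M f a" and g: "L2_le M g b" and k: "k \<in> borel_measurable M"
    and le: "AE \<omega> in M. norm (k \<omega>) \<le> norm (f \<omega>) + norm (g \<omega>)"
  shows "L2_le M k (a + b)"
proof -
  have nn: "0 \<le> a" "0 \<le> b" using f g by (auto simp: L2_le_def)
  have "(\<integral>\<^sup>+ \<omega>. ennreal ((norm (k \<omega>))\<^sup>2) \<partial>M) \<le> ennreal ((a + b)\<^sup>2)"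
  proof (rule le_ennreal_square_of_add_epsilon)
    fix \<delta> :: real assume "0 < \<delta>"
    then have "L2_le M f (a + \<delta> / 2)" "L2_le M g (b + \<delta> / 2)" "0 < a + \<delta> / 2" "0 < b + \<delta> / 2"
      using nn by (auto intro: L2_le_mono[OF f] L2_le_mono[OF g])
    from L2_le_triangle_pos[OF this le]
    show "(\<integral>\<^sup>+ \<omega>. ennreal ((norm (k \<omega>))\<^sup>2) \<partial>M) \<le> ennreal ((a + b + \<delta>)\<^sup>2)"
      by (simp add: algebra_simps)
  qed (use nn in auto)
  with k nn show ?thesis by (auto simp: L2_le_def)
qed

lemma L2_le_scale:
  fixes f :: "'w \<Rightarrow> 'a::real_normed_vector" and k :: "'w \<Rightarrow> 'c::real_normed_vector"
  assumes f: "L2_le M f a" and k: "k \<in> borel_measurable M" and c: "0 \<le> c"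
    and le: "AE \<omega> in M. norm (k \<omega>) \<le> c * norm (f \<omega>)"
  shows "L2_le M k (c * a)"
proof -
  have [measurable]: "f \<in> borel_measurable M"
    using f by (auto simp: L2_le_def)
  have "(\<integral>\<^sup>+ \<omega>. ennreal ((norm (k \<omega>))\<^sup>2) \<partial>M)
      \<le> (\<integral>\<^sup>+ \<omega>. ennreal (c\<^sup>2) * ennreal ((norm (f \<omega>))\<^sup>2) \<partial>M)"
  proof (rule nn_integral_mono_AE)
    show "AE \<omega> in M. ennreal ((norm (k \<omega>))\<^sup>2) \<le> ennreal (c\<^sup>2) * ennreal ((norm (f \<omega>))\<^sup>2)"
      using le
    proof eventually_elim
      case (elim \<omega>)
      then have "(norm (k \<omega>))\<^sup>2 \<le> (c * norm (f \<omega>))\<^sup>2" by (intro power_mono) auto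
      then show ?case by (simp flip: ennreal_mult add: ennreal_leI power_mult_distrib)
    qed
  qed
  also have "\<dots> = ennreal (c\<^sup>2) * (\<integral>\<^sup>+ \<omega>. ennreal ((norm (f \<omega>))\<^sup>2) \<partial>M)"
    by (simp add: nn_integral_cmult)
  also have "\<dots> \<le> ennreal (c\<^sup>2) * ennreal (a\<^sup>2)"
    using f by (intro mult_left_mono) (auto simp: L2_le_def)
  also have "\<dots> = ennreal ((c * a)\<^sup>2)"
    by (simp flip: ennreal_mult add: power_mult_distrib)
  finally show ?thesis using assms by (auto simp: L2_le_def)
qed

lemma L2_le_triangle3:
  fixes f :: "'w \<Rightarrow> 'a::real_normed_vector" and g :: "'w \<Rightarrow> 'b::real_normed_vector"
    and l :: "'w \<Rightarrow> 'c::real_normed_vector" and k :: "'w \<Rightarrow> 'd::real_normed_vector"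
  assumes f: "L2_le M f a" and g: "L2_le M g b" and l: "L2_le M l d" and k: "k \<in> borel_measurable M"
    and c: "0 \<le> c1" "0 \<le> c2" "0 \<le> c3"
    and le: "AE \<omega> in M. norm (k \<omega>) \<le> c1 * norm (f \<omega>) + c2 * norm (g \<omega>) + c3 * norm (l \<omega>)"
  shows "L2_le M k (c1 * a + c2 * b + c3 * d)"
proof -
  have [measurable]: "f \<in> borel_measurable M" "g \<in> borel_measurable M" "l \<in> borel_measurable M"
    using f g l by (auto simp: L2_le_def)
  have scaled: "L2_le M (\<lambda>\<omega>. c1 * norm (f \<omega>)) (c1 * a)" "L2_le M (\<lambda>\<omega>. c2 * norm (g \<omega>)) (c2 * b)"
    "L2_le M (\<lambda>\<omega>. c3 * norm (l \<omega>)) (c3 * d)"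
    using c by (auto intro!: L2_le_scale[OF f] L2_le_scale[OF g] L2_le_scale[OF l] simp: abs_mult)
  from scaled(1,2) have "L2_le M (\<lambda>\<omega>. c1 * norm (f \<omega>) + c2 * norm (g \<omega>)) (c1 * a + c2 * b)"
    by (rule L2_le_triangle) (use c in auto)
  then show ?thesis
    using scaled(3) k
  proof (rule L2_le_triangle)
    show "AE \<omega> in M. norm (k \<omega>) \<le> norm (c1 * norm (f \<omega>) + c2 * norm (g \<omega>)) + norm (c3 * norm (l \<omega>))"
      using le by eventually_elim (use c in auto)
  qed
qed

lemma esqrt_le_iff:
  assumes "0 \<le> c"
  shows "esqrt a \<le> ennreal c \<longleftrightarrow> a \<le> ennreal (c\<^sup>2)"
proof (cases a)
  case (real r)
  have "sqrt r \<le> c \<longleftrightarrow> r \<le> c\<^sup>2"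
    using assms real by (metis real_sqrt_le_iff real_sqrt_unique real_sqrt_pow2 real_sqrt_abs abs_of_nonneg)
  then show ?thesis using real assms by (simp add: esqrt_def ennreal_le_iff)
qed (simp add: esqrt_def top_unique)

text \<open>A residual is quadratic in the error, so its mean square is governed by the fourth
  moment of the error. (A2) brings this back to the second moment, which is what lets the induction
  close.\<close>

lemma L2_le_square_of_fourth_moment:
  fixes e :: "'w \<Rightarrow> 'a::real_normed_vector"
  assumes e: "L2_le M e c" and \<alpha>: "0 \<le> \<alpha>"
    and fourth: "esqrt (\<integral>\<^sup>+ \<omega>. ennreal ((norm (e \<omega>)) ^ 4) \<partial>M)
       \<le> ennreal \<alpha> * (\<integral>\<^sup>+ \<omega>. ennreal ((norm (e \<omega>))\<^sup>2) \<partial>M)"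
  shows "L2_le M (\<lambda>\<omega>. (norm (e \<omega>))\<^sup>2) (\<alpha> * c\<^sup>2)"
proof -
  have [measurable]: "e \<in> borel_measurable M" using e by (auto simp: L2_le_def)
  have "esqrt (\<integral>\<^sup>+ \<omega>. ennreal ((norm (e \<omega>)) ^ 4) \<partial>M) \<le> ennreal \<alpha> * ennreal (c\<^sup>2)"
    using e by (intro order_trans[OF fourth] mult_left_mono) (auto simp: L2_le_def)
  also have "\<dots> = ennreal (\<alpha> * c\<^sup>2)" using \<alpha> by (simp add: ennreal_mult)
  finally show ?thesis using \<alpha> by (simp add: esqrt_le_iff L2_le_def flip: power_mult)
qed

section \<open>Stability of the Wasserstein distance\<close>

text \<open>On \<open>a = b\<close> the factors are coupled independently, conditionally on the common
  discrete value.\<close>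

lemma discrete_gluing:
  fixes a :: "'a \<Rightarrow> nat" and b :: "'b \<Rightarrow> nat"
  assumes M: "prob_space M" and P: "prob_space P"
    and a[measurable]: "a \<in> measurable M (count_space UNIV)"
    and b[measurable]: "b \<in> measurable P (count_space UNIV)"
    and eq: "\<And>n. emeasure M {x \<in> space M. a x = n} = emeasure P {y \<in> space P. b y = n}"
  obtains G where "sets G = sets (M \<Otimes>\<^sub>M P)" "distr G M fst = M" "distr G P snd = P"
    "AE z in G. a (fst z) = b (snd z)"
proof -
  interpret M: prob_space M by fact
  interpret P: prob_space P by fact
  interpret MP: pair_sigma_finite M P ..
  define p where "p n = emeasure M {x \<in> space M. a x = n}" for n
  \<comment> \<open>The set where both values equal \<open>n\<close> has product mass
    \<open>p n * p n\<close>; dividing by \<open>p n\<close> leaves \<open>p n\<close>, as both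
    marginals demand.\<close>
  define D where "D z = (if a (fst z) = b (snd z) then inverse (p (a (fst z))) else 0)" for z
  have [measurable]: "(\<lambda>n. inverse (p n)) \<in> measurable (count_space UNIV) borel" by simp
  have [measurable]: "(\<lambda>z. a (fst z)) \<in> measurable (M \<Otimes>\<^sub>M P) (count_space UNIV)"
    "(\<lambda>z. b (snd z)) \<in> measurable (M \<Otimes>\<^sub>M P) (count_space UNIV)"
    using measurable_compose[OF measurable_fst a] measurable_compose[OF measurable_snd b] by simp_all
  \<comment> \<open>Equality of the two values is written as a countable union over the common value
    to obtain measurability.\<close>
  have "Measurable.pred (M \<Otimes>\<^sub>M P) (\<lambda>z. \<exists>n. a (fst z) = n \<and> b (snd z) = n)" by measurable
  then have [measurable]: "Measurable.pred (M \<Otimes>\<^sub>M P) (\<lambda>z. a (fst z) = b (snd z))"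
    by (simp add: eq_commute)
  have [measurable]: "D \<in> borel_measurable (M \<Otimes>\<^sub>M P)"
  proof -
    have [measurable]: "(\<lambda>z. inverse (p (a (fst z)))) \<in> borel_measurable (M \<Otimes>\<^sub>M P)"
      by (rule measurable_compose[of _ _ "count_space UNIV" "\<lambda>n. inverse (p n)"]) measurable
    show ?thesis unfolding D_def by measurable
  qed
  define G where "G = density (M \<Otimes>\<^sub>M P) D"
  have p_fin: "p n \<noteq> \<infinity>" for n by (simp add: p_def)
  have one: "inverse (p n) * p n = 1" if "p n \<noteq> 0" for n
    using that p_fin[of n] ennreal_divide_self[of "p n"]
    by (simp add: divide_ennreal_def mult.commute top.not_eq_extremum)
  \<comment> \<open>If \<open>p n = 0\<close>, the density is infinite there and
    \<open>inverse (p n) * p n\<close> is 0 instead of 1 in \<open>ennreal\<close>. Such values are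
    null events under both measures.\<close>
  have AE_a: "AE x in M. p (a x) \<noteq> 0"
  proof -
    have "AE x in M. \<forall>n. p n = 0 \<longrightarrow> a x \<noteq> n"
      unfolding AE_all_countable
    proof
      fix n show "AE x in M. p n = 0 \<longrightarrow> a x \<noteq> n"
        by (cases "p n = 0") (auto simp: p_def AE_iff_measurable[OF _ refl])
    qed
    then show ?thesis by eventually_elim auto
  qed
  have AE_b: "AE x in P. p (b x) \<noteq> 0"
  proof -
    have "AE x in P. \<forall>n. p n = 0 \<longrightarrow> b x \<noteq> n"
      unfolding AE_all_countable
    proof
      fix n show "AE x in P. p n = 0 \<longrightarrow> b x \<noteq> n"
        by (cases "p n = 0") (auto simp: p_def eq AE_iff_measurable[OF _ refl])
    qed
    then show ?thesis by eventually_elim auto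
  qed
  have int_b: "(\<integral>\<^sup>+ y. D (x, y) \<partial>P) = inverse (p (a x)) * p (a x)" for x
  proof -
    have "(\<integral>\<^sup>+ y. D (x, y) \<partial>P)
        = (\<integral>\<^sup>+ y. inverse (p (a x)) * indicator {y \<in> space P. b y = a x} y \<partial>P)"
      by (intro nn_integral_cong) (auto simp: D_def)
    also have "\<dots> = inverse (p (a x)) * p (a x)"
      by (subst nn_integral_cmult_indicator) (auto simp: p_def eq)
    finally show ?thesis .
  qed
  have int_a: "(\<integral>\<^sup>+ x. D (x, y) \<partial>M) = inverse (p (b y)) * p (b y)" for y
  proof -
    have "(\<integral>\<^sup>+ x. D (x, y) \<partial>M)
        = (\<integral>\<^sup>+ x. inverse (p (b y)) * indicator {x \<in> space M. a x = b y} x \<partial>M)"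
      by (intro nn_integral_cong) (auto simp: D_def)
    also have "\<dots> = inverse (p (b y)) * p (b y)"
      by (subst nn_integral_cmult_indicator) (auto simp: p_def)
    finally show ?thesis .
  qed
  have sets_G: "sets G = sets (M \<Otimes>\<^sub>M P)" by (simp add: G_def)
  have "distr G M fst = M"
  proof (rule measure_eqI)
    fix E assume "E \<in> sets (distr G M fst)"
    then have E[measurable]: "E \<in> sets M" by simp
    have "emeasure (distr G M fst) E = emeasure G (fst -` E \<inter> space (M \<Otimes>\<^sub>M P))"
      by (subst emeasure_distr) (auto simp: G_def)
    also have "\<dots> = (\<integral>\<^sup>+ z. D z * indicator (fst -` E \<inter> space (M \<Otimes>\<^sub>M P)) z \<partial>(M \<Otimes>\<^sub>M P))"
      unfolding G_def by (rule emeasure_density) auto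
    also have "\<dots> = (\<integral>\<^sup>+ z. D z * indicator E (fst z) \<partial>(M \<Otimes>\<^sub>M P))"
      by (intro nn_integral_cong) (auto simp: indicator_def)
    also have "\<dots> = (\<integral>\<^sup>+ x. \<integral>\<^sup>+ y. D (x, y) * indicator E x \<partial>P \<partial>M)"
      by (subst P.nn_integral_fst[symmetric]) auto
    also have "\<dots> = (\<integral>\<^sup>+ x. (\<integral>\<^sup>+ y. D (x, y) \<partial>P) * indicator E x \<partial>M)"
      by (intro nn_integral_cong nn_integral_multc) measurable
    also have "\<dots> = (\<integral>\<^sup>+ x. indicator E x \<partial>M)"
      using AE_a by (intro nn_integral_cong_AE) (auto simp: int_b one)
    finally show "emeasure (distr G M fst) E = emeasure M E" by simp
  qed simp
  moreover have "distr G P snd = P"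
  proof (rule measure_eqI)
    fix E assume "E \<in> sets (distr G P snd)"
    then have E[measurable]: "E \<in> sets P" by simp
    have "emeasure (distr G P snd) E = emeasure G (snd -` E \<inter> space (M \<Otimes>\<^sub>M P))"
      by (subst emeasure_distr) (auto simp: G_def)
    also have "\<dots> = (\<integral>\<^sup>+ z. D z * indicator (snd -` E \<inter> space (M \<Otimes>\<^sub>M P)) z \<partial>(M \<Otimes>\<^sub>M P))"
      unfolding G_def by (rule emeasure_density) auto
    also have "\<dots> = (\<integral>\<^sup>+ z. D z * indicator E (snd z) \<partial>(M \<Otimes>\<^sub>M P))"
      by (intro nn_integral_cong) (auto simp: indicator_def)
    also have "\<dots> = (\<integral>\<^sup>+ y. \<integral>\<^sup>+ x. D (x, y) * indicator E y \<partial>M \<partial>P)"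
      by (subst MP.nn_integral_snd[symmetric]) auto
    also have "\<dots> = (\<integral>\<^sup>+ y. (\<integral>\<^sup>+ x. D (x, y) \<partial>M) * indicator E y \<partial>P)"
      by (intro nn_integral_cong nn_integral_multc) measurable
    also have "\<dots> = (\<integral>\<^sup>+ y. indicator E y \<partial>P)"
      using AE_b by (intro nn_integral_cong_AE) (auto simp: int_a one)
    finally show "emeasure (distr G P snd) E = emeasure P E" by simp
  qed simp
  moreover have "AE z in G. a (fst z) = b (snd z)"
    unfolding G_def by (subst AE_density) (auto simp: D_def)
  ultimately show thesis using that sets_G by blast
qed

text \<open>Points are labelled by the first member of a dense sequence closer than
  \<open>\<delta> / 2\<close>; equal labels mean a common centre. Labels have countable range, so
  they can be glued exactly, at the price of an error \<open>\<delta>\<close> in the points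
  themselves.\<close>

lemma ex_small_cells:
  assumes "0 < (\<delta>::real)"
  obtains c :: "'a::{metric_space, second_countable_topology} \<Rightarrow> nat"
  where "c \<in> measurable borel (count_space UNIV)" "\<And>x y. c x = c y \<Longrightarrow> dist x y \<le> \<delta>"
proof -
  obtain D :: "'a set" where D: "countable D" "\<And>X. open X \<Longrightarrow> X \<noteq> {} \<Longrightarrow> \<exists>d\<in>D. d \<in> X"
    using countable_dense_setE by metis
  have "D \<noteq> {}" using D(2)[OF open_UNIV] by auto
  define d where "d = from_nat_into D"
  define c where "c x = (LEAST n. dist x (d n) < \<delta> / 2)" for x
  have "\<exists>n. dist x (d n) < \<delta> / 2" for x
  proof -
    obtain e where "e \<in> D" "e \<in> ball x (\<delta> / 2)"
      using D(2)[of "ball x (\<delta> / 2)"] assms by (metis centre_in_ball open_ball empty_iff half_gt_zero)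
    then show ?thesis using from_nat_into_surj[OF D(1), of e] by (auto simp: d_def)
  qed
  then have near: "dist x (d (c x)) < \<delta> / 2" for x
    unfolding c_def by (rule LeastI_ex)
  have "c \<in> measurable borel (count_space UNIV)" unfolding c_def by measurable
  moreover have "dist x y \<le> \<delta>" if "c x = c y" for x y
    using near[of x] near[of y] that dist_triangle_half_r[of "d (c x)" x \<delta> y]
    by (simp add: dist_commute)
  ultimately show thesis using that by blast
qed

lemma couplings_prob_space:
  assumes "\<pi> \<in> couplings P Q" "prob_space P"
  shows "prob_space \<pi>"
proof -
  have "fst \<in> measurable \<pi> borel"
    using assms by (auto simp: couplings_def cong: measurable_cong_sets)
  moreover have "prob_space (distr \<pi> borel fst)" using assms by (auto simp: couplings_def)
  ultimately show ?thesis by (rule prob_space_distrD)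
qed

text \<open>A finite bound forces the set of couplings to be nonempty, as an infimum over the empty
  set is infinite. The slack \<open>\<delta>\<close> replaces attainment of the infimum.\<close>

lemma W2_le_imp_coupling:
  fixes P Q :: "'a::euclidean_space measure"
  assumes "W2 P Q \<le> ennreal c" "0 \<le> c" "0 < \<delta>"
  obtains \<pi> where "\<pi> \<in> couplings P Q" "L2_le \<pi> (\<lambda>z. fst z - snd z) (c + \<delta>)"
proof -
  have "(INF \<pi>\<in>couplings P Q. \<integral>\<^sup>+ z. ennreal ((norm (fst z - snd z))\<^sup>2) \<partial>\<pi>) \<le> ennreal (c\<^sup>2)"
    using assms by (simp add: W2_def esqrt_le_iff)
  also have "\<dots> < ennreal ((c + \<delta>)\<^sup>2)"
    using assms by (intro ennreal_lessI) (auto intro: power_strict_mono)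
  finally obtain \<pi> where \<pi>: "\<pi> \<in> couplings P Q"
    "(\<integral>\<^sup>+ z. ennreal ((norm (fst z - snd z))\<^sup>2) \<partial>\<pi>) < ennreal ((c + \<delta>)\<^sup>2)"
    by (auto simp: INF_less_iff)
  have "(\<lambda>z::'a \<times> 'a. fst z - snd z) \<in> borel_measurable \<pi>"
    using \<pi> by (auto simp: couplings_def cong: measurable_cong_sets)
  then show thesis using \<pi> assms by (intro that) (auto simp: L2_le_def)
qed

lemma W2_le_of_couplings:
  fixes P Q :: "'a::euclidean_space measure"
  assumes "0 \<le> c"
    and "\<And>\<delta>. 0 < \<delta> \<Longrightarrow> \<exists>\<pi>\<in>couplings P Q. L2_le \<pi> (\<lambda>z. fst z - snd z) (c + \<delta>)"
  shows "W2 P Q \<le> ennreal c"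
  unfolding W2_def esqrt_le_iff[OF assms(1)]
proof (rule le_ennreal_square_of_add_epsilon)
  fix \<delta> :: real assume "0 < \<delta>"
  from assms(2)[OF this] obtain \<pi> where "\<pi> \<in> couplings P Q" "L2_le \<pi> (\<lambda>z. fst z - snd z) (c + \<delta>)"
    by auto
  then show "(INF \<pi>\<in>couplings P Q. \<integral>\<^sup>+ z. ennreal ((norm (fst z - snd z))\<^sup>2) \<partial>\<pi>)
      \<le> ennreal ((c + \<delta>)\<^sup>2)"
    by (auto simp: L2_le_def intro: INF_lower2)
qed (use assms in auto)

lemma L2_le_distr:
  fixes g :: "'b \<Rightarrow> 'c::{real_normed_vector, second_countable_topology}"
  assumes "T \<in> measurable M N" "g \<in> borel_measurable N"
  shows "L2_le (distr M N T) g c \<longleftrightarrow> L2_le M (\<lambda>\<omega>. g (T \<omega>)) c"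
  using assms by (auto simp: L2_le_def nn_integral_distr)

text \<open>A coupling of the law of \<open>X\<close> with \<open>Q\<close> lives on a space that
  knows nothing of \<open>Y\<close>. It is glued to \<open>M\<close> itself, not to the law of
  \<open>X\<close>, along the cells of \<open>X\<close>. On the glued space, \<open>Y\<close> minus
  the \<open>Q\<close>-coordinate splits into \<open>Y - X\<close>, the cost of the coupling, and
  the discrepancy of two points in one cell, contributing \<open>d\<close>,
  \<open>c + \<delta> / 2\<close> and \<open>\<delta> / 2\<close>.\<close>

lemma W2_perturb:
  fixes X Y :: "'w \<Rightarrow> 'a::euclidean_space"
  assumes M: "prob_space M"
    and X[measurable]: "X \<in> borel_measurable M" and Y[measurable]: "Y \<in> borel_measurable M"
    and W: "W2 (distr M borel X) Q \<le> ennreal c" and c: "0 \<le> c"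
    and XY: "L2_le M (\<lambda>\<omega>. Y \<omega> - X \<omega>) d"
  shows "W2 (distr M borel Y) Q \<le> ennreal (c + d)"
proof (rule W2_le_of_couplings)
  show "0 \<le> c + d" using c XY by (auto simp: L2_le_def)
next
  fix \<delta> :: real assume \<delta>: "0 < \<delta>"
  obtain \<pi> where \<pi>: "\<pi> \<in> couplings (distr M borel X) Q" and cost: "L2_le \<pi> (\<lambda>z. fst z - snd z) (c + \<delta> / 2)"
    using W2_le_imp_coupling[OF W c, of "\<delta> / 2"] \<delta> by auto
  have s\<pi>[measurable_cong]: "sets \<pi> = sets (borel \<Otimes>\<^sub>M borel)"
    and m1: "distr \<pi> borel fst = distr M borel X" and m2: "distr \<pi> borel snd = Q"
    using \<pi> by (auto simp: couplings_def)
  have P: "prob_space \<pi>"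
    using couplings_prob_space[OF \<pi>] prob_space.prob_space_distr[OF M X] by auto
  obtain k :: "'a \<Rightarrow> nat" where k[measurable]: "k \<in> measurable borel (count_space UNIV)"
    and small: "\<And>x y. k x = k y \<Longrightarrow> dist x y \<le> \<delta> / 2"
    using ex_small_cells[of "\<delta> / 2"] \<delta> by auto
  have "emeasure M {x \<in> space M. k (X x) = n} = emeasure \<pi> {y \<in> space \<pi>. k (fst y) = n}" for n
  proof -
    have "emeasure M {x \<in> space M. k (X x) = n} = emeasure (distr M borel X) {z. k z = n}"
      by (subst emeasure_distr) (auto intro!: arg_cong[where f="emeasure M"])
    also have "\<dots> = emeasure \<pi> {y \<in> space \<pi>. k (fst y) = n}"
      unfolding m1[symmetric] by (subst emeasure_distr) (auto intro!: arg_cong[where f="emeasure \<pi>"])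
    finally show ?thesis .
  qed
  then obtain G where G: "sets G = sets (M \<Otimes>\<^sub>M \<pi>)" "distr G M fst = M" "distr G \<pi> snd = \<pi>"
      "AE z in G. k (X (fst z)) = k (fst (snd z))"
    using discrete_gluing[OF M P, of "\<lambda>x. k (X x)" "\<lambda>y. k (fst y)"] by force
  note [measurable_cong] = G(1)
  have G1[measurable]: "fst \<in> measurable G M" and G2[measurable]: "snd \<in> measurable G \<pi>" by simp_all
  interpret G: prob_space G
    using prob_space_distrD[OF G1] M G(2) by simp
  have Gm: "(\<lambda>z. fst (snd z)) \<in> borel_measurable G" "(\<lambda>z. snd (snd z)) \<in> borel_measurable G"
    using measurable_compose[OF G2, of fst borel] measurable_compose[OF G2, of snd borel] by simp_all
  note [measurable] = Gm
  have "L2_le G (\<lambda>z. Y (fst z) - X (fst z)) d"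
    using XY L2_le_distr[OF G1, of "\<lambda>\<omega>. Y \<omega> - X \<omega>" d] G(2) by simp
  moreover have "L2_le G (\<lambda>z. fst (snd z) - snd (snd z)) (c + \<delta> / 2)"
    using cost L2_le_distr[OF G2, of "\<lambda>z. fst z - snd z" "c + \<delta> / 2"] G(3) by simp
  ultimately have sum: "L2_le G (\<lambda>z. norm (Y (fst z) - X (fst z)) + norm (fst (snd z) - snd (snd z))) (d + (c + \<delta> / 2))"
    by (rule L2_le_triangle) simp_all
  \<comment> \<open>This constant stands for the distance between \<open>X\<close> and the first
    coordinate of the coupling, which share a cell almost everywhere.\<close>
  have "L2_le G (\<lambda>z. \<delta> / 2) (\<delta> / 2)"
    using \<delta> by (auto simp: L2_le_def G.emeasure_space_1)
  with sum have "L2_le G (\<lambda>z. Y (fst z) - snd (snd z)) (d + (c + \<delta> / 2) + \<delta> / 2)"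
  proof (rule L2_le_triangle)
    show "AE z in G. norm (Y (fst z) - snd (snd z))
        \<le> norm (norm (Y (fst z) - X (fst z)) + norm (fst (snd z) - snd (snd z))) + norm (\<delta> / 2)"
      using G(4)
    proof eventually_elim
      case (elim z)
      have "Y (fst z) - snd (snd z) = (Y (fst z) - X (fst z)) + (fst (snd z) - snd (snd z)) + (X (fst z) - fst (snd z))"
        by simp
      then show ?case using small[OF elim] \<delta> unfolding dist_norm
        by (smt (verit) norm_triangle_ineq real_norm_def norm_ge_zero)
    qed
  qed measurable
  then have L: "L2_le G (\<lambda>z. Y (fst z) - snd (snd z)) (c + d + \<delta>)" by (simp add: algebra_simps)
  define \<pi>' where "\<pi>' = distr G (borel \<Otimes>\<^sub>M borel) (\<lambda>z. (Y (fst z), snd (snd z)))"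
  have "distr \<pi>' borel fst = distr (distr G M fst) borel Y"
    unfolding \<pi>'_def by (simp add: distr_distr comp_def)
  moreover have "distr \<pi>' borel snd = distr (distr G \<pi> snd) borel snd"
    unfolding \<pi>'_def by (subst (1 2) distr_distr) (auto simp: comp_def)
  ultimately have "\<pi>' \<in> couplings (distr M borel Y) Q"
    by (simp add: couplings_def G m2) (simp add: \<pi>'_def)
  moreover have "L2_le \<pi>' (\<lambda>z. fst z - snd z) (c + d + \<delta>)"
    unfolding \<pi>'_def using L by (subst L2_le_distr) auto
  ultimately show "\<exists>\<pi>\<in>couplings (distr M borel Y) Q. L2_le \<pi> (\<lambda>z. fst z - snd z) (c + d + \<delta>)"
    by blast
qed

section \<open>Second moments of Gaussian measures\<close>

text \<open>The uniqueness argument for Haar measure, applied to the image of Lebesgue measure under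
  \<open>T\<close>. The factor is left unidentified, which avoids determinants: every later use
  fixes it by comparing total masses of probability densities.\<close>

lemma lborel_linear_image:
  fixes T :: "'a::euclidean_space \<Rightarrow> 'a"
  assumes T: "linear T" "bij T"
  obtains c where "\<And>g. g \<in> borel_measurable borel \<Longrightarrow>
    (\<integral>\<^sup>+ y. g (T y) \<partial>lborel) = c * (\<integral>\<^sup>+ z. g z \<partial>lborel)"
proof -
  define B :: "'a set" where "B = cbox 0 One"
  have B: "emeasure lborel B = 1" by (simp add: B_def emeasure_lborel_cbox_eq)
  have [measurable]: "B \<in> sets borel" by (simp add: B_def)
  have [measurable]: "T \<in> borel_measurable borel"
    using T(1) by (intro borel_measurable_continuous_onI linear_continuous_on) (simp add: linear_linear)
  define c where "c = (\<integral>\<^sup>+ y. indicator B (- T y) \<partial>lborel)"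
  have shift: "(\<integral>\<^sup>+ y. g (y + a) \<partial>lborel) = (\<integral>\<^sup>+ y. g y \<partial>lborel)"
    if [measurable]: "g \<in> borel_measurable borel" for g :: "'a \<Rightarrow> ennreal" and a
    by (subst lborel_distr_plus[of a, symmetric], subst nn_integral_distr) (auto simp: add.commute)
  have "(\<integral>\<^sup>+ y. g (T y) \<partial>lborel) = c * (\<integral>\<^sup>+ z. g z \<partial>lborel)"
    if g[measurable]: "g \<in> borel_measurable borel" for g :: "'a \<Rightarrow> ennreal"
  proof -
    have shiftT: "(\<integral>\<^sup>+ y. k (T y + a) \<partial>lborel) = (\<integral>\<^sup>+ y. k (T y) \<partial>lborel)"
      if [measurable]: "k \<in> borel_measurable borel" for k :: "'a \<Rightarrow> ennreal" and a
    proof -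
      obtain b where "a = T b" using T(2) by (metis bij_pointE)
      then show ?thesis
        using shift[of "\<lambda>y. k (T y)" b] by (simp add: linear_add[OF T(1)])
    qed
    \<comment> \<open>The inserted factor is the volume 1 of the cube. Shifting \<open>z\<close> by
      \<open>- T y\<close>, exchanging the integrals and shifting \<open>y\<close> by a preimage of
      \<open>z\<close> moves \<open>z\<close> from the indicator into \<open>g\<close>; a second
      exchange then separates the two factors.\<close>
    have "(\<integral>\<^sup>+ y. g (T y) \<partial>lborel) = (\<integral>\<^sup>+ y. g (T y) * (\<integral>\<^sup>+ z. indicator B z \<partial>lborel) \<partial>lborel)"
      by (simp add: B)
    also have "\<dots> = (\<integral>\<^sup>+ y. g (T y) * (\<integral>\<^sup>+ z. indicator B (z + (- T y)) \<partial>lborel) \<partial>lborel)"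
      by (subst shift) simp_all
    also have "\<dots> = (\<integral>\<^sup>+ y. (\<integral>\<^sup>+ z. g (T y) * indicator B (z + (- T y)) \<partial>lborel) \<partial>lborel)"
      by (subst nn_integral_cmult) simp_all
    also have "\<dots> = (\<integral>\<^sup>+ z. (\<integral>\<^sup>+ y. g (T y) * indicator B (z + (- T y)) \<partial>lborel) \<partial>lborel)"
      by (rule lborel_pair.Fubini') measurable
    also have "\<dots> = (\<integral>\<^sup>+ z. (\<integral>\<^sup>+ y. g (T y + z) * indicator B (- T y) \<partial>lborel) \<partial>lborel)"
    proof (rule nn_integral_cong)
      fix z
      show "(\<integral>\<^sup>+ y. g (T y) * indicator B (z + (- T y)) \<partial>lborel)
          = (\<integral>\<^sup>+ y. g (T y + z) * indicator B (- T y) \<partial>lborel)"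
        using shiftT[of "\<lambda>x. g x * indicator B (z + (- x))" z] by simp
    qed
    also have "\<dots> = (\<integral>\<^sup>+ y. (\<integral>\<^sup>+ z. g (T y + z) * indicator B (- T y) \<partial>lborel) \<partial>lborel)"
      by (rule lborel_pair.Fubini') measurable
    also have "\<dots> = (\<integral>\<^sup>+ y. (\<integral>\<^sup>+ z. g (z + T y) \<partial>lborel) * indicator B (- T y) \<partial>lborel)"
      by (subst nn_integral_multc) (simp_all add: add.commute)
    also have "\<dots> = c * (\<integral>\<^sup>+ z. g z \<partial>lborel)"
      by (subst shift) (simp_all add: c_def nn_integral_cmult mult.commute)
    finally show ?thesis .
  qed
  then show thesis by (rule that)
qed

definition std_gauss :: "'a::euclidean_space \<Rightarrow> real" where
  "std_gauss y = (\<Prod>b\<in>Basis. std_normal_density (y \<bullet> b))"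

text \<open>The product form in the definition suits coordinatewise integration. This radial form
  shows rotation invariance and matches the exponent of \<open>gaussian\<close>.\<close>

lemma std_gauss_eq: "std_gauss (y::'a::euclidean_space) = exp (- (y \<bullet> y) / 2) / sqrt (2 * pi) ^ DIM('a)"
proof -
  have "std_gauss y = (\<Prod>b\<in>Basis. (1 / sqrt (2 * pi)) * exp (- (y \<bullet> b)\<^sup>2 / 2))"
    by (simp only: std_gauss_def std_normal_density_def)
  also have "\<dots> = (1 / sqrt (2 * pi)) ^ DIM('a) * exp (\<Sum>b\<in>Basis. - (y \<bullet> b)\<^sup>2 / 2)"
    by (subst prod.distrib) (simp add: exp_sum)
  also have "(\<Sum>b\<in>Basis. - (y \<bullet> b)\<^sup>2 / 2) = - (y \<bullet> y) / 2"
    by (subst (2) euclidean_inner) (simp add: sum_divide_distrib sum_negf power2_eq_square)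
  finally show ?thesis by (simp add: power_one_over)
qed

lemma std_gauss_nonneg: "0 \<le> std_gauss y"
  by (simp add: std_gauss_def prod_nonneg)

lemma borel_measurable_std_gauss[measurable]: "std_gauss \<in> borel_measurable borel"
  unfolding std_gauss_def[abs_def] by measurable

lemma nn_integral_std_normal_density: "(\<integral>\<^sup>+ x. ennreal (std_normal_density x) \<partial>lborel) = 1"
  by (subst nn_integral_eq_integral) auto

lemma nn_integral_std_normal_second_moment:
  "(\<integral>\<^sup>+ x. ennreal (x\<^sup>2 * std_normal_density x) \<partial>lborel) = 1"
proof -
  have "has_bochner_integral lborel (\<lambda>x. std_normal_density x * x ^ (2 * 1)) (fact (2 * 1) / (2^1 * fact 1))"
    by (rule std_normal_moment_even)
  then have "has_bochner_integral lborel (\<lambda>x. x\<^sup>2 * std_normal_density x) 1"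
    by (simp add: mult.commute)
  then show ?thesis
    by (subst nn_integral_eq_integral) (auto simp: has_bochner_integral_iff)
qed

lemma nn_integral_std_gauss: "(\<integral>\<^sup>+ y. ennreal (std_gauss y) \<partial>lborel) = 1"
proof -
  have "(\<integral>\<^sup>+ y. ennreal (std_gauss y) \<partial>(lborel :: 'a measure))
      = (\<Prod>b\<in>(Basis :: 'a set). (\<integral>\<^sup>+x. ennreal (std_normal_density x) \<partial>lborel))"
    unfolding std_gauss_def
    by (subst nn_integral_lborel_prod[symmetric]) (auto simp: prod_ennreal)
  then show ?thesis by (simp add: nn_integral_std_normal_density)
qed

lemma nn_integral_std_gauss_Basis:
  fixes e :: "'a::euclidean_space"
  assumes e: "e \<in> Basis"
  shows "(\<integral>\<^sup>+ y. ennreal ((e \<bullet> y)\<^sup>2 * std_gauss y) \<partial>lborel) = 1"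
proof -
  let ?f = "\<lambda>b x. if b = e then x\<^sup>2 * std_normal_density x else std_normal_density x"
  have "(e \<bullet> y)\<^sup>2 * std_gauss y = (\<Prod>b\<in>Basis. ?f b (y \<bullet> b))" for y
    using e unfolding std_gauss_def
    by (subst (1 2) prod.remove[OF _ e]) (auto simp: inner_commute intro!: prod.cong)
  then have "(\<integral>\<^sup>+ y. ennreal ((e \<bullet> y)\<^sup>2 * std_gauss y) \<partial>lborel)
      = (\<integral>\<^sup>+ y. (\<Prod>b\<in>Basis. ennreal (?f b (y \<bullet> b))) \<partial>lborel)"
    by (subst prod_ennreal) auto
  also have "\<dots> = (\<Prod>b\<in>Basis. (\<integral>\<^sup>+ x. ennreal (?f b x) \<partial>lborel))"
    by (rule nn_integral_lborel_prod) auto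
  also have "\<dots> = 1"
  proof (intro prod.neutral ballI)
    fix b :: 'a
    show "(\<integral>\<^sup>+ x. ennreal (?f b x) \<partial>lborel) = 1"
      by (cases "b = e")
        (simp_all only: simp_thms if_True if_False nn_integral_std_normal_second_moment nn_integral_std_normal_density)
  qed
  finally show ?thesis .
qed

text \<open>Rotation invariance reduces to a coordinate direction.\<close>

lemma nn_integral_std_gauss_second_moment:
  fixes q :: "real^'k"
  shows "(\<integral>\<^sup>+ y. ennreal ((q \<bullet> y)\<^sup>2 * std_gauss y) \<partial>lborel) = ennreal ((norm q)\<^sup>2)"
proof -
  obtain e :: "real^'k" where e: "e \<in> Basis" using SOME_Basis by blast
  have "norm (norm q *\<^sub>R e) = norm q" using e by simp
  then obtain T where T: "orthogonal_transformation T" and Te: "T (norm q *\<^sub>R e) = q"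
    using orthogonal_transformation_exists[of "norm q *\<^sub>R e" q] by auto
  have lin: "linear T" and inv: "\<And>x y. T x \<bullet> T y = x \<bullet> y"
    using T by (auto simp: orthogonal_transformation_def)
  have bij: "bij T" using T by (rule orthogonal_transformation_bij)
  have inv_gauss: "std_gauss (T y) = std_gauss y" for y
    by (simp add: std_gauss_eq inv)
  obtain c where c: "\<And>g. g \<in> borel_measurable borel \<Longrightarrow>
      (\<integral>\<^sup>+ y. g (T y) \<partial>lborel) = c * (\<integral>\<^sup>+ z. g z \<partial>lborel)"
    using lborel_linear_image[OF lin bij] by blast
  \<comment> \<open>Both sides are the total mass of the rotation-invariant density, so an
    orthogonal map preserves Lebesgue measure.\<close>
  have "c = 1"
    using c[of "\<lambda>y. ennreal (std_gauss y)"] by (simp add: inv_gauss nn_integral_std_gauss)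
  have "(\<integral>\<^sup>+ y. ennreal ((q \<bullet> y)\<^sup>2 * std_gauss y) \<partial>lborel)
      = (\<integral>\<^sup>+ y. ennreal ((q \<bullet> T y)\<^sup>2 * std_gauss (T y)) \<partial>lborel)"
    using c[of "\<lambda>y. ennreal ((q \<bullet> y)\<^sup>2 * std_gauss y)"] \<open>c = 1\<close> by simp
  also have "\<dots> = (\<integral>\<^sup>+ y. ennreal ((norm q)\<^sup>2) * ennreal ((e \<bullet> y)\<^sup>2 * std_gauss y) \<partial>lborel)"
  proof (intro nn_integral_cong)
    fix y
    have "q \<bullet> T y = norm q * (e \<bullet> y)"
      using inv[of "norm q *\<^sub>R e" y] by (simp add: Te)
    then show "ennreal ((q \<bullet> T y)\<^sup>2 * std_gauss (T y))
        = ennreal ((norm q)\<^sup>2) * ennreal ((e \<bullet> y)\<^sup>2 * std_gauss y)"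
      by (simp add: inv_gauss power_mult_distrib mult.assoc std_gauss_nonneg flip: ennreal_mult)
  qed
  also have "\<dots> = ennreal ((norm q)\<^sup>2)"
    by (subst nn_integral_cmult) (auto simp: nn_integral_std_gauss_Basis[OF e])
  finally show ?thesis .
qed

text \<open>Gram-Schmidt for the inner product given by \<open>P\<close>: an orthonormal family for
  this form is built one index at a time and becomes the columns of \<open>Q\<close>.\<close>

lemma pos_def_congruent_identity:
  fixes P :: "real^'k^'k"
  assumes P: "pos_def P"
  obtains Q :: "real^'k^'k" where "transpose Q ** P ** Q = mat 1"
proof -
  have sym: "x \<bullet> (P *v y) = y \<bullet> (P *v x)" for x y
    using P by (metis dot_lmul_matrix inner_commute pos_def_def transpose_matrix_vector)
  have "finite I \<Longrightarrow> \<exists>b :: 'k \<Rightarrow> real^'k. \<forall>i\<in>I. \<forall>j\<in>I. b i \<bullet> (P *v b j) = (if i = j then 1 else 0)"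
    for I :: "'k set"
  proof (induction I rule: finite_induct)
    case (insert k I)
    then obtain b :: "'k \<Rightarrow> real^'k"
      where b: "\<And>i j. i \<in> I \<Longrightarrow> j \<in> I \<Longrightarrow> b i \<bullet> (P *v b j) = (if i = j then 1 else 0)" by blast
    \<comment> \<open>Fewer than \<open>CARD('k)\<close> vectors \<open>P *v b i\<close> span a
      proper subspace; a vector orthogonal to it in the Euclidean sense is orthogonal to every
      \<open>b i\<close> in the form \<open>P\<close>.\<close>
    let ?D = "(\<lambda>i. P *v b i) ` I"
    have "dim ?D \<le> card ?D" using insert by (intro dim_le_card') simp
    also have "\<dots> \<le> card I" using insert by (intro card_image_le)
    also have "\<dots> < CARD('k)" using insert by (intro psubset_card_mono) auto
    finally have "dim ?D < DIM(real^'k)" by simp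
    then obtain x where x: "x \<noteq> 0" "\<And>y. y \<in> span ?D \<Longrightarrow> orthogonal x y"
      using orthogonal_to_subspace_exists by blast
    have ortho: "x \<bullet> (P *v b i) = 0" if "i \<in> I" for i
      using x(2)[of "P *v b i"] that by (auto simp: orthogonal_def intro: span_base)
    have pos: "0 < x \<bullet> (P *v x)" using P x(1) by (simp add: pos_def_def)
    define r where "r = 1 / sqrt (x \<bullet> (P *v x))"
    have r: "r * r * (x \<bullet> (P *v x)) = 1"
      using pos by (simp add: r_def field_simps)
    let ?b = "b(k := r *\<^sub>R x)"
    have "\<forall>i\<in>insert k I. \<forall>j\<in>insert k I. ?b i \<bullet> (P *v ?b j) = (if i = j then 1 else 0)"
      using insert(2) b ortho r
      by (auto simp: matrix_vector_mult_scaleR sym[of "b _" x] mult.assoc)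
    then show ?case by blast
  qed simp
  then obtain b :: "'k \<Rightarrow> real^'k" where b: "\<And>i j. b i \<bullet> (P *v b j) = (if i = j then 1 else 0)"
    using finite[of "UNIV :: 'k set"] by (metis UNIV_I)
  let ?Q = "(\<chi> i j. b j $ i) :: real^'k^'k"
  have "(transpose ?Q ** (P ** ?Q)) $ i $ j = b i \<bullet> (P *v b j)" for i j
    by (simp add: matrix_matrix_mult_def matrix_vector_mult_def transpose_def inner_vec_def)
  then have "transpose ?Q ** P ** ?Q = mat 1"
    by (simp add: vec_eq_iff b mat_def flip: matrix_mul_assoc)
  then show thesis by (rule that)
qed

lemma matrix_inv_works:
  fixes S :: "real^'k^'k"
  assumes "invertible S"
  shows "S ** matrix_inv S = mat 1" "matrix_inv S ** S = mat 1"
  using someI_ex[OF assms[unfolded invertible_def]] by (auto simp: matrix_inv_def)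

lemma pos_def_invertible:
  assumes "pos_def S"
  shows "invertible S"
proof -
  have "x = 0" if "S *v x = 0" for x
    using assms that by (metis inner_zero_right less_irrefl pos_def_def)
  then show ?thesis
    by (simp add: invertible_left_inverse matrix_left_invertible_ker)
qed

lemma pos_def_matrix_inv:
  assumes S: "pos_def S"
  shows "pos_def (matrix_inv S)"
proof -
  let ?P = "matrix_inv S"
  note inv = matrix_inv_works[OF pos_def_invertible[OF S]]
  have tS: "transpose S = S" using S by (simp add: pos_def_def)
  have "transpose ?P = transpose ?P ** (S ** ?P)" by (simp add: inv)
  also have "\<dots> = transpose (S ** ?P) ** ?P"
    by (simp add: matrix_mul_assoc matrix_transpose_mul tS)
  finally have "transpose ?P = ?P" by (simp add: inv transpose_mat)
  moreover have "0 < z \<bullet> (?P *v z)" if "z \<noteq> 0" for z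
  proof -
    have z: "S *v (?P *v z) = z" by (simp add: matrix_vector_mul_assoc inv)
    then have "?P *v z \<noteq> 0" using that by auto
    then have "0 < (?P *v z) \<bullet> (S *v (?P *v z))" using S by (simp add: pos_def_def)
    then show ?thesis by (simp add: z inner_commute)
  qed
  ultimately show ?thesis by (simp add: pos_def_def)
qed

text \<open>Orthonormalising the form of \<open>matrix_inv S\<close>, rather than that of
  \<open>S\<close>, gives both facts at once: \<open>S = Q ** transpose Q\<close>, and the
  substitution by \<open>Q\<close> turns the Gaussian exponent into the standard one.\<close>

lemma pos_def_factorization:
  fixes S :: "real^'k^'k"
  assumes S: "pos_def S"
  obtains Q :: "real^'k^'k" where "S = Q ** transpose Q" "invertible Q"
    "\<And>y. (Q *v y) \<bullet> (matrix_inv S *v (Q *v y)) = y \<bullet> y"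
proof -
  let ?P = "matrix_inv S"
  note inv = matrix_inv_works[OF pos_def_invertible[OF S]]
  obtain Q :: "real^'k^'k" where Q: "transpose Q ** ?P ** Q = mat 1"
    by (rule pos_def_congruent_identity[OF pos_def_matrix_inv[OF S]])
  then have Q': "Q ** (transpose Q ** ?P) = mat 1"
    using matrix_left_right_inverse[of "transpose Q ** ?P" Q] by blast
  have "S = Q ** (transpose Q ** ?P) ** S" by (simp only: Q' matrix_mul_lid)
  also have "\<dots> = Q ** transpose Q" by (simp only: inv matrix_mul_rid flip: matrix_mul_assoc)
  finally have 1: "S = Q ** transpose Q" .
  have 2: "invertible Q" using Q Q' unfolding invertible_def by blast
  have "(Q *v y) \<bullet> (?P *v (Q *v y)) = y \<bullet> y" for y
  proof -
    have "y \<bullet> ((transpose Q ** ?P ** Q) *v y) = (Q *v y) \<bullet> (?P *v (Q *v y))"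
      by (metis dot_lmul_matrix inner_commute matrix_vector_mul_assoc transpose_matrix_vector transpose_transpose)
    then show ?thesis by (simp add: Q)
  qed
  with 1 2 show thesis by (rule that)
qed

text \<open>The normalizing constant is not computed: that the total mass is \<open>1\<close> determines the
  scaling factor of the substitution \<open>z = \<mu> + Q y\<close>.\<close>

lemma gaussian_second_moment:
  fixes S :: "real^'k^'k"
  assumes S: "pos_def S" and prob: "prob_space (gaussian \<mu> S)"
  shows "(\<integral>\<^sup>+ z. ennreal (((z - \<mu>) $ i)\<^sup>2) \<partial>gaussian \<mu> S) = ennreal (S $ i $ i)"
proof -
  obtain Q :: "real^'k^'k" where Q: "S = Q ** transpose Q" "invertible Q"
    "\<And>y. (Q *v y) \<bullet> (matrix_inv S *v (Q *v y)) = y \<bullet> y"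
    using pos_def_factorization[OF S] by blast
  define D where "D x = exp (- (x \<bullet> (matrix_inv S *v x)) / 2) / sqrt ((2 * pi) ^ CARD('k) * det S)" for x
  have [measurable]: "D \<in> borel_measurable borel"
    unfolding D_def by (intro borel_measurable_divide borel_measurable_const borel_measurable_continuous_onI continuous_intros) simp
  \<comment> \<open>The quotient of the two normalizing constants, left over once the exponents
    agree.\<close>
  define K where "K = sqrt (2 * pi) ^ CARD('k) / sqrt ((2 * pi) ^ CARD('k) * det S)"
  have D: "D (Q *v y) = K * std_gauss y" for y
    by (simp add: D_def K_def Q(3) std_gauss_eq)
  have int: "(\<integral>\<^sup>+ z. g (z - \<mu>) \<partial>gaussian \<mu> S) = (\<integral>\<^sup>+ x. g x * ennreal (D x) \<partial>lborel)"
    if [measurable]: "g \<in> borel_measurable borel" for g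
  proof -
    have "(\<integral>\<^sup>+ z. g (z - \<mu>) \<partial>gaussian \<mu> S) = (\<integral>\<^sup>+ z. ennreal (D (z - \<mu>)) * g (z - \<mu>) \<partial>lborel)"
      unfolding gaussian_def D_def[symmetric] by (subst nn_integral_density) auto
    also have "\<dots> = (\<integral>\<^sup>+ x. g x * ennreal (D x) \<partial>lborel)"
      by (subst lborel_distr_plus[of \<mu>, symmetric], subst nn_integral_distr)
        (auto simp: mult.commute)
    finally show ?thesis .
  qed
  have lin: "linear ((*v) Q)" by simp
  have bij: "bij ((*v) Q)" using Q(2) by (metis invertible_eq_bij)
  obtain c where c: "\<And>g. g \<in> borel_measurable borel \<Longrightarrow>
      (\<integral>\<^sup>+ y. g (Q *v y) \<partial>lborel) = c * (\<integral>\<^sup>+ z. g z \<partial>lborel)"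
    using lborel_linear_image[OF lin bij] by blast
  have mass: "(\<integral>\<^sup>+ x. ennreal (D x) \<partial>lborel) = 1"
    using int[of "\<lambda>_. 1"] prob_space.emeasure_space_1[OF prob] by simp
  have "c = (\<integral>\<^sup>+ y. ennreal (D (Q *v y)) \<partial>lborel)"
    using c[of "\<lambda>x. ennreal (D x)"] by (simp add: mass)
  also have "\<dots> = ennreal K"
    by (simp add: D ennreal_mult'' std_gauss_nonneg nn_integral_cmult nn_integral_std_gauss)
  finally have cK: "c = ennreal K" .
  \<comment> \<open>The sign of \<open>det S\<close> is read off from the total mass: if it were
    zero, division by zero would make the density 0; if negative, \<open>sqrt\<close> would be
    negative and the density would truncate to 0 in \<open>ennreal\<close>. Both contradict mass
    1.\<close>
  have "K \<noteq> 0"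
  proof
    assume "K = 0"
    then have "sqrt ((2 * pi) ^ CARD('k) * det S) = 0" by (simp add: K_def)
    then have "D = (\<lambda>_. 0)" unfolding D_def by (simp only: div_by_0)
    with mass show False by simp
  qed
  moreover have "0 \<le> K"
  proof (rule ccontr)
    assume "\<not> 0 \<le> K"
    then have "sqrt ((2 * pi) ^ CARD('k) * det S) \<le> 0"
      by (auto simp: K_def not_le divide_less_0_iff)
    then have "D x \<le> 0" for x unfolding D_def by (intro divide_nonneg_nonpos) auto
    then have "ennreal (D x) = 0" for x by (simp add: ennreal_eq_0_iff)
    with mass show False by simp
  qed
  ultimately have K: "0 < K" by simp
  have row: "(Q *v y) $ i = row i Q \<bullet> y" for y
    by (simp add: matrix_vector_mult_def row_def inner_vec_def)
  have "ennreal K * (\<integral>\<^sup>+ z. ennreal (((z - \<mu>) $ i)\<^sup>2) \<partial>gaussian \<mu> S)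
      = c * (\<integral>\<^sup>+ x. ennreal ((x $ i)\<^sup>2) * ennreal (D x) \<partial>lborel)"
    using int[of "\<lambda>x. ennreal ((x $ i)\<^sup>2)"] by (simp add: cK)
  also have "\<dots> = (\<integral>\<^sup>+ y. ennreal (((Q *v y) $ i)\<^sup>2) * ennreal (D (Q *v y)) \<partial>lborel)"
    by (subst c) auto
  also have "\<dots> = (\<integral>\<^sup>+ y. ennreal K * ennreal ((row i Q \<bullet> y)\<^sup>2 * std_gauss y) \<partial>lborel)"
    using K by (intro nn_integral_cong)
      (simp add: D row std_gauss_nonneg mult_ac flip: ennreal_mult)
  also have "\<dots> = ennreal K * ennreal ((norm (row i Q))\<^sup>2)"
    by (subst nn_integral_cmult) (auto simp: nn_integral_std_gauss_second_moment)
  also have "(norm (row i Q))\<^sup>2 = S $ i $ i"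
    by (simp add: Q(1) power2_norm_eq_inner matrix_matrix_mult_def transpose_def row_def inner_vec_def)
  finally show ?thesis
    using K by (simp add: ennreal_mult_cancel_left)
qed

section \<open>Linearization residuals\<close>

lemma norm_matrix_vector_le_spectral_norm: "norm (A *v z) \<le> spectral_norm A * norm z"
  unfolding spectral_norm_def by (intro onorm matrix_vector_mul_bounded_linear)

lemma spectral_norm_nonneg: "0 \<le> spectral_norm A"
  unfolding spectral_norm_def by (intro onorm_pos_le matrix_vector_mul_bounded_linear)

text \<open>The curve \<open>?\<phi>\<close> runs from \<open>g c\<close> to
  \<open>g (c + e) - ?J c *v e\<close>, and its speed at \<open>s\<close> is at most
  \<open>L * s * (norm e)\<^sup>2\<close>. The majorant \<open>?\<psi>\<close> has exactly this
  derivative, whence the factor \<open>1 / 2\<close>. The Lipschitz bound is asked for on the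
  segment only, which is what (A1) provides for a nonconvex neighbourhood.\<close>

lemma residual_bound:
  fixes g :: "real^'k \<Rightarrow> real^'l"
  assumes diff: "\<And>z. g differentiable (at z)"
    and Lip: "\<And>z. z \<in> closed_segment c (c + e) \<Longrightarrow>
      spectral_norm (jacobian g (at z) - jacobian g (at c)) \<le> L * norm (z - c)"
  shows "norm (residual g c e) \<le> L / 2 * (norm e)\<^sup>2"
proof -
  let ?J = "\<lambda>z. jacobian g (at z)"
  let ?\<phi> = "\<lambda>s. g (c + s *\<^sub>R e) - s *\<^sub>R (?J c *v e)"
  let ?\<psi> = "\<lambda>s. L / 2 * s\<^sup>2 * (norm e)\<^sup>2"
  have deriv: "(?\<phi> has_vector_derivative (?J (c + s *\<^sub>R e) *v e - ?J c *v e)) (at s)" for s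
  proof -
    have g: "(g has_derivative (\<lambda>d. ?J (c + s *\<^sub>R e) *v d)) (at (c + s *\<^sub>R e))"
      using diff jacobian_works by blast
    have "((\<lambda>s. c + s *\<^sub>R e) has_vector_derivative e) (at s)"
      by (auto intro!: derivative_eq_intros)
    then have "((\<lambda>s. g (c + s *\<^sub>R e)) has_vector_derivative (?J (c + s *\<^sub>R e) *v e)) (at s)"
      using vector_derivative_diff_chain_within[of "\<lambda>s. c + s *\<^sub>R e" e s UNIV g] g
      by (simp add: o_def has_derivative_at_withinI)
    then show ?thesis by (auto intro!: derivative_eq_intros)
  qed
  have "norm (?\<phi> 1 - ?\<phi> 0) \<le> ?\<psi> 1 - ?\<psi> 0"
  proof (rule differentiable_bound_general)
    show "continuous_on {0..1} ?\<phi>"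
      using deriv by (intro continuous_at_imp_continuous_on ballI) (meson has_vector_derivative_continuous)
    show "continuous_on {0..1} ?\<psi>" by (intro continuous_intros)
    show "(?\<phi> has_vector_derivative (?J (c + s *\<^sub>R e) *v e - ?J c *v e)) (at s)" for s by (rule deriv)
    show "(?\<psi> has_vector_derivative (L * s * (norm e)\<^sup>2)) (at s)" for s
      by (auto simp flip: has_real_derivative_iff_has_vector_derivative intro!: derivative_eq_intros)
    show "norm (?J (c + s *\<^sub>R e) *v e - ?J c *v e) \<le> L * s * (norm e)\<^sup>2" if s: "0 < s" "s < 1" for s
    proof -
      have "c + s *\<^sub>R e \<in> closed_segment c (c + e)"
        using s by (auto simp: in_segment algebra_simps intro!: exI[of _ s])
      from Lip[OF this] have "spectral_norm (?J (c + s *\<^sub>R e) - ?J c) \<le> L * (s * norm e)"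
        using s by simp
      then have "spectral_norm (?J (c + s *\<^sub>R e) - ?J c) * norm e \<le> L * (s * norm e) * norm e"
        by (rule mult_right_mono) simp
      then show ?thesis
        using norm_matrix_vector_le_spectral_norm[of "?J (c + s *\<^sub>R e) - ?J c" e]
        by (simp add: matrix_vector_mult_diff_rdistrib power2_eq_square mult.assoc)
    qed
  qed simp
  then show ?thesis by (simp add: residual_def algebra_simps)
qed

section \<open>Stacked vectors and measurability\<close>

lemma norm_stack: "(norm (stack p q))\<^sup>2 = (norm p)\<^sup>2 + (norm q)\<^sup>2"
proof -
  have "(norm (stack p q))\<^sup>2 = (\<Sum>i\<in>UNIV <+> UNIV. stack p q $ i * stack p q $ i)"
    by (simp add: power2_norm_eq_inner inner_vec_def)
  then show ?thesis
    by (simp only: sum.Plus finite power2_norm_eq_inner inner_vec_def) (simp add: stack_def)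
qed

lemma stack_diff: "stack p q - stack p' q' = stack (p - p') (q - q')"
  by (auto simp: vec_eq_iff stack_def split: sum.split)

lemma ex_stack: "\<exists>p q. z = stack p q"
  by (intro exI[of _ "\<chi> i. z $ Inl i"] exI[of _ "\<chi> i. z $ Inr i"])
    (auto simp: vec_eq_iff stack_def split: sum.split)

lemma block_diag_mult_stack: "block_diag A B *v stack p q = stack (A *v p) (B *v q)"
proof -
  have "(block_diag A B *v stack p q) $ i = (\<Sum>j\<in>UNIV <+> UNIV. block_diag A B $ i $ j * stack p q $ j)" for i
    by (simp add: matrix_vector_mult_def)
  then show ?thesis
    by (simp only: vec_eq_iff sum.Plus finite)
      (auto simp: block_diag_def block_matrix_def stack_def matrix_vector_mult_def split: sum.split)
qed

lemma inner_stack: "stack p q \<bullet> stack p' q' = p \<bullet> p' + q \<bullet> q'"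
proof -
  have "stack p q \<bullet> stack p' q' = (\<Sum>i\<in>UNIV <+> UNIV. stack p q $ i * stack p' q' $ i)"
    by (simp add: inner_vec_def)
  then show ?thesis
    by (simp only: sum.Plus finite inner_vec_def) (simp add: stack_def)
qed

lemma symmetric_entries:
  assumes "transpose A = A"
  shows "A $ i $ j = A $ j $ i"
proof -
  have "A $ i $ j = transpose A $ j $ i" by (simp add: transpose_def)
  then show ?thesis by (simp only: assms)
qed

lemma pos_def_block_diag:
  fixes A :: "real^'a^'a" and B :: "real^'b^'b"
  assumes A: "pos_def A" and B: "pos_def B"
  shows "pos_def (block_diag A B)"
proof -
  have "transpose A = A" "transpose B = B" using A B by (simp_all add: pos_def_def)
  then have "A $ i $ j = A $ j $ i" "B $ k $ l = B $ l $ k" for i j k l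
    using symmetric_entries by blast+
  then have "transpose (block_diag A B) = block_diag A B"
    by (auto simp: vec_eq_iff transpose_def block_diag_def block_matrix_def split: sum.split)
  moreover have "0 < z \<bullet> (block_diag A B *v z)" if z: "z \<noteq> 0" for z
  proof -
    obtain p q where pq: "z = stack p q" using ex_stack by blast
    have "stack 0 0 = (0 :: real^('a + 'b))"
      by (simp add: vec_eq_iff stack_def split: sum.split)
    with z pq have "p \<noteq> 0 \<or> q \<noteq> 0" by auto
    moreover have "0 \<le> p \<bullet> (A *v p)" "0 \<le> q \<bullet> (B *v q)"
      using A B by (metis inner_zero_left less_imp_le order_refl pos_def_def)+
    ultimately have "0 < p \<bullet> (A *v p) + q \<bullet> (B *v q)"
      using A B by (meson add_nonneg_pos add_pos_nonneg pos_def_def)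
    then show ?thesis by (simp add: pq block_diag_mult_stack inner_stack)
  qed
  ultimately show ?thesis by (simp add: pos_def_def)
qed

lemma pos_def_diagonal_nonneg:
  assumes "pos_def S" shows "0 \<le> S $ i $ i"
proof -
  have "0 < axis i 1 \<bullet> (S *v axis i 1)"
    using assms by (simp add: pos_def_def axis_eq_0_iff)
  then show ?thesis by (simp add: inner_axis' matrix_vector_mul_component inner_axis less_imp_le)
qed

lemma borel_measurable_vec_nth[measurable]:
  fixes F :: "'w \<Rightarrow> 'a::euclidean_space^'k"
  assumes "F \<in> borel_measurable M"
  shows "(\<lambda>\<omega>. F \<omega> $ i) \<in> borel_measurable M"
  by (rule measurable_compose[OF assms borel_measurable_continuous_onI])
    (intro continuous_intros)

lemma borel_measurable_vecI:
  fixes F :: "'w \<Rightarrow> 'a::euclidean_space^'k"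
  assumes "\<And>i. (\<lambda>\<omega>. F \<omega> $ i) \<in> borel_measurable M"
  shows "F \<in> borel_measurable M"
  unfolding borel_measurable_euclidean_space[of F]
proof
  fix b :: "'a^'k" assume "b \<in> Basis"
  then obtain i c where b: "b = axis i c" by (auto simp: Basis_vec_def)
  have "(\<lambda>\<omega>. F \<omega> $ i \<bullet> c) \<in> borel_measurable M" using assms[of i] by measurable
  then show "(\<lambda>\<omega>. F \<omega> \<bullet> b) \<in> borel_measurable M" by (simp add: b inner_axis)
qed

lemma borel_measurable_stack[measurable]:
  fixes X :: "'w \<Rightarrow> real^'a" and Y :: "'w \<Rightarrow> real^'b"
  assumes [measurable]: "X \<in> borel_measurable M" "Y \<in> borel_measurable M"
  shows "(\<lambda>\<omega>. stack (X \<omega>) (Y \<omega>)) \<in> borel_measurable M"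
proof (rule borel_measurable_vecI)
  fix i :: "'a + 'b"
  show "(\<lambda>\<omega>. stack (X \<omega>) (Y \<omega>) $ i) \<in> borel_measurable M"
    by (cases i) (simp_all add: stack_def)
qed

lemma L2_le_stack:
  fixes X :: "'w \<Rightarrow> real^'n" and Y :: "'w \<Rightarrow> real^'m"
  assumes X: "L2_le M X a" and Y: "L2_le M Y b"
  shows "L2_le M (\<lambda>\<omega>. stack (X \<omega>) (Y \<omega>)) (sqrt (a\<^sup>2 + b\<^sup>2))"
proof -
  have [measurable]: "X \<in> borel_measurable M" "Y \<in> borel_measurable M"
    using X Y by (auto simp: L2_le_def)
  have "(\<integral>\<^sup>+ \<omega>. ennreal ((norm (stack (X \<omega>) (Y \<omega>)))\<^sup>2) \<partial>M)
      = (\<integral>\<^sup>+ \<omega>. ennreal ((norm (X \<omega>))\<^sup>2) \<partial>M) + (\<integral>\<^sup>+ \<omega>. ennreal ((norm (Y \<omega>))\<^sup>2) \<partial>M)"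
    by (simp add: norm_stack nn_integral_add)
  also have "\<dots> \<le> ennreal (a\<^sup>2) + ennreal (b\<^sup>2)"
    using X Y by (intro add_mono) (auto simp: L2_le_def)
  finally show ?thesis by (simp add: L2_le_def)
qed

lemma borel_measurable_matrix_mult[measurable]:
  fixes A :: "'w \<Rightarrow> real^'b^'a" and B :: "'w \<Rightarrow> real^'c^'b"
  assumes [measurable]: "A \<in> borel_measurable M" "B \<in> borel_measurable M"
  shows "(\<lambda>\<omega>. A \<omega> ** B \<omega>) \<in> borel_measurable M"
  by (intro borel_measurable_vecI) (simp add: matrix_matrix_mult_def)

lemma borel_measurable_matrix_vector_mult[measurable]:
  fixes A :: "'w \<Rightarrow> real^'b^'a" and z :: "'w \<Rightarrow> real^'b"
  assumes [measurable]: "A \<in> borel_measurable M" "z \<in> borel_measurable M"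
  shows "(\<lambda>\<omega>. A \<omega> *v z \<omega>) \<in> borel_measurable M"
  by (intro borel_measurable_vecI) (simp add: matrix_vector_mult_def)

lemma borel_measurable_transpose[measurable]:
  fixes A :: "'w \<Rightarrow> real^'b^'a"
  assumes [measurable]: "A \<in> borel_measurable M"
  shows "(\<lambda>\<omega>. transpose (A \<omega>)) \<in> borel_measurable M"
  by (intro borel_measurable_vecI) (simp add: transpose_def)

lemma borel_measurable_det[measurable]:
  fixes A :: "'w \<Rightarrow> real^'k^'k"
  assumes [measurable]: "A \<in> borel_measurable M"
  shows "(\<lambda>\<omega>. det (A \<omega>)) \<in> borel_measurable M"
  unfolding det_def by measurable

text \<open>On singular matrices \<open>matrix_inv\<close> takes an unspecified but constant value.\<close>

lemma matrix_inv_cramer: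
  fixes A :: "real^'k^'k"
  shows "matrix_inv A = (if det A = 0 then SOME B. False
    else (\<chi> k j. det (\<chi> i l. if l = k then axis j 1 $ i else A $ i $ l) / det A))"
proof (cases "det A = 0")
  case True
  then have "\<not> invertible A" by (simp add: invertible_det_nz)
  then have "(\<lambda>B. A ** B = mat 1 \<and> B ** A = mat 1) = (\<lambda>_. False)"
    by (auto simp: invertible_def)
  then show ?thesis using True by (simp add: matrix_inv_def)
next
  case False
  then have inv: "A ** matrix_inv A = mat 1"
    by (simp add: matrix_inv_works invertible_det_nz)
  have "A *v column j (matrix_inv A) = axis j 1" for j
    using inv by (simp add: vec_eq_iff matrix_vector_mult_def matrix_matrix_mult_def column_def mat_def axis_def)
  then have "column j (matrix_inv A)
      = (\<chi> k. det (\<chi> i l. if l = k then axis j 1 $ i else A $ i $ l) / det A)" for j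
    using cramer[OF False] by blast
  then show ?thesis using False by (simp add: vec_eq_iff column_def)
qed

text \<open>Cramer's rule writes the entries as quotients of determinants. Together with the
  constant value on singular matrices, this makes the gain measurable without first proving the
  innovation covariance invertible.\<close>

lemma borel_measurable_matrix_inv[measurable]:
  fixes A :: "'w \<Rightarrow> real^'k^'k"
  assumes [measurable]: "A \<in> borel_measurable M"
  shows "(\<lambda>\<omega>. matrix_inv (A \<omega>)) \<in> borel_measurable M"
proof -
  have "(\<lambda>\<omega>. \<chi> i l. if l = k then axis j 1 $ i else A \<omega> $ i $ l) \<in> borel_measurable M" for k j :: 'k
    by (intro borel_measurable_vecI) simp
  then have "(\<lambda>\<omega>. \<chi> k j. det (\<chi> i l. if l = k then axis j 1 $ i else A \<omega> $ i $ l) / det (A \<omega>))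
      \<in> borel_measurable M"
    by (intro borel_measurable_vecI) (simp add: borel_measurable_divide borel_measurable_det)
  then show ?thesis unfolding matrix_inv_cramer by measurable
qed

lemma C2_differentiable:
  assumes "twice_continuously_differentiable g"
  shows "g differentiable (at z)"
  using assms unfolding twice_continuously_differentiable_def differentiable_def by blast

lemma C2_continuous:
  assumes "twice_continuously_differentiable g"
  shows "continuous_on UNIV g"
  using C2_differentiable[OF assms]
  by (intro continuous_at_imp_continuous_on ballI differentiable_imp_continuous_within)

lemma C2_continuous_frechet_derivative:
  assumes "twice_continuously_differentiable g"
  shows "continuous_on UNIV (\<lambda>z. frechet_derivative g (at z) d)"
proof -
  obtain g' g'' where g': "\<And>z. (g has_derivative blinfun_apply (g' z)) (at z)"
    "\<And>z. (g' has_derivative blinfun_apply (g'' z)) (at z)"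
    using assms unfolding twice_continuously_differentiable_def by blast
  have "continuous_on UNIV g'"
    using g'(2) by (intro continuous_at_imp_continuous_on ballI) (rule has_derivative_continuous)
  then have "continuous_on UNIV (\<lambda>z. blinfun_apply (g' z) d)" by (intro continuous_intros)
  moreover have "frechet_derivative g (at z) = blinfun_apply (g' z)" for z
    using frechet_derivative_at[OF g'(1)] by simp
  ultimately show ?thesis by simp
qed

lemma borel_measurable_jacobian:
  fixes h :: "real^'k \<Rightarrow> real^'l"
  assumes h: "twice_continuously_differentiable h" and [measurable]: "X \<in> borel_measurable M"
  shows "(\<lambda>\<omega>. jacobian h (at (X \<omega>))) \<in> borel_measurable M"
proof -
  have [measurable]: "(\<lambda>z. frechet_derivative h (at z) d) \<in> borel_measurable borel" for d
    by (intro borel_measurable_continuous_onI C2_continuous_frechet_derivative h)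
  show ?thesis
    by (intro borel_measurable_vecI) (simp add: jacobian_def matrix_def)
qed

lemma has_derivative_partial:
  fixes f :: "(real^'n) \<times> (real^'p) \<Rightarrow> real^'l"
  assumes "twice_continuously_differentiable f"
  shows "((\<lambda>\<xi>. f (\<xi>, a)) has_derivative (\<lambda>d. frechet_derivative f (at (z, a)) (d, 0))) (at z)"
proof -
  have f: "(f has_derivative frechet_derivative f (at (z, a))) (at (z, a))"
    using C2_differentiable[OF assms] frechet_derivative_works by blast
  have "((\<lambda>\<xi>. (\<xi>, a)) has_derivative (\<lambda>d. (d, 0))) (at z)"
    by (auto intro!: derivative_eq_intros)
  from has_derivative_compose[OF this f] show ?thesis .
qed

lemma differentiable_partial:
  fixes f :: "(real^'n) \<times> (real^'p) \<Rightarrow> real^'l"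
  assumes "twice_continuously_differentiable f"
  shows "(\<lambda>\<xi>. f (\<xi>, a)) differentiable (at z)"
  using has_derivative_partial[OF assms] unfolding differentiable_def by blast

text \<open>The input varies with the outcome, so continuity in the state for a fixed input is not
  enough. The partial Jacobian is read off from the total derivative, which is continuous in state
  and input jointly.\<close>

lemma borel_measurable_jacobian_partial:
  fixes f :: "(real^'n) \<times> (real^'p) \<Rightarrow> real^'l"
  assumes f: "twice_continuously_differentiable f"
    and [measurable]: "X \<in> borel_measurable M" "a \<in> borel_measurable M"
  shows "(\<lambda>\<omega>. jacobian (\<lambda>\<xi>. f (\<xi>, a \<omega>)) (at (X \<omega>))) \<in> borel_measurable M"
proof -
  have [measurable]: "(\<lambda>z. frechet_derivative f (at z) d) \<in> borel_measurable borel" for d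
    by (intro borel_measurable_continuous_onI C2_continuous_frechet_derivative f)
  have [measurable]: "(\<lambda>\<omega>. (X \<omega>, a \<omega>)) \<in> borel_measurable M"
    by (intro borel_measurable_Pair) simp_all
  have "(\<lambda>\<omega>. frechet_derivative f (at (X \<omega>, a \<omega>)) d) \<in> borel_measurable M" for d
    by (rule measurable_compose[of "\<lambda>\<omega>. (X \<omega>, a \<omega>)" M borel]) measurable
  moreover have "frechet_derivative (\<lambda>\<xi>. f (\<xi>, b)) (at z) = (\<lambda>d. frechet_derivative f (at (z, b)) (d, 0))" for b z
    using frechet_derivative_at[OF has_derivative_partial[OF f]] by simp
  ultimately show ?thesis
    by (intro borel_measurable_vecI) (simp add: jacobian_def matrix_def)
qed

text \<open>Measurability is asked only of the observations in \<open>I\<close>. This permits its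
  use inside an induction over time, when only past observations are known to be measurable.\<close>

lemma borel_measurable_generated_algebra:
  assumes X: "\<And>i. i \<in> I \<Longrightarrow> X i \<in> borel_measurable M"
    and F: "F \<in> borel_measurable (generated_algebra M X I)"
  shows "F \<in> borel_measurable M"
proof -
  let ?G = "{X i -` B \<inter> space M | i B. i \<in> I \<and> B \<in> sets borel}"
  have G: "?G \<subseteq> sets M" using X by (auto simp: measurable_sets)
  then have "?G \<subseteq> Pow (space M)" using sets.sets_into_space by blast
  then have "space (generated_algebra M X I) = space M"
    "sets (generated_algebra M X I) = sigma_sets (space M) ?G"
    by (simp_all add: generated_algebra_def space_measure_of_conv)
  with G have "subalgebra M (generated_algebra M X I)"
    by (simp add: subalgebra_def sets.sigma_sets_subset)
  then show ?thesis using F by (rule measurable_from_subalg)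
qed

section \<open>Marginals of the nominal law\<close>

text \<open>Selecting coordinates along an index map treats both blocks of a stacked vector
  uniformly, with \<open>Inl\<close> and \<open>Inr\<close> as the maps.\<close>

definition subvector :: "('k::finite \<Rightarrow> 'j::finite) \<Rightarrow> real^'j \<Rightarrow> real^'k" where
  "subvector \<iota> z = (\<chi> i. z $ \<iota> i)"

lemma norm_subvector: "(norm (subvector \<iota> z))\<^sup>2 = (\<Sum>i\<in>UNIV. (z $ \<iota> i)\<^sup>2)"
  unfolding power2_norm_eq_inner inner_vec_def by (simp add: subvector_def power2_eq_square)

lemma norm_subvector_le:
  assumes "inj \<iota>" shows "norm (subvector \<iota> z) \<le> norm z"
proof -
  have "(norm (subvector \<iota> z))\<^sup>2 = (\<Sum>i\<in>range \<iota>. (z $ i)\<^sup>2)"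
    by (simp add: norm_subvector sum.reindex[OF assms])
  also have "\<dots> \<le> (\<Sum>i\<in>UNIV. (z $ i)\<^sup>2)" by (rule sum_mono2) auto
  also have "\<dots> = (norm z)\<^sup>2"
    unfolding power2_norm_eq_inner inner_vec_def by (simp add: power2_eq_square)
  finally show ?thesis by simp
qed

lemma borel_measurable_subvector[measurable]:
  assumes [measurable]: "X \<in> borel_measurable M"
  shows "(\<lambda>\<omega>. subvector \<iota> (X \<omega>)) \<in> borel_measurable M"
  by (intro borel_measurable_vecI) (simp add: subvector_def)

lemma L2_le_subvector_gaussian:
  fixes S :: "real^'j^'j" and \<iota> :: "'k::finite \<Rightarrow> 'j"
  assumes S: "pos_def S" and G: "prob_space (gaussian \<mu> S)"
  shows "L2_le (gaussian \<mu> S) (\<lambda>z. subvector \<iota> (z - \<mu>)) (sqrt (\<Sum>i\<in>UNIV. S $ \<iota> i $ \<iota> i))"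
proof -
  have [measurable_cong]: "sets (gaussian \<mu> S) = sets borel" by (simp add: gaussian_def)
  have nn: "0 \<le> (\<Sum>i\<in>UNIV. S $ \<iota> i $ \<iota> i)"
    by (intro sum_nonneg pos_def_diagonal_nonneg S)
  have "(\<integral>\<^sup>+ z. ennreal ((norm (subvector \<iota> (z - \<mu>)))\<^sup>2) \<partial>gaussian \<mu> S)
      = (\<integral>\<^sup>+ z. (\<Sum>i\<in>UNIV. ennreal (((z - \<mu>) $ \<iota> i)\<^sup>2)) \<partial>gaussian \<mu> S)"
    by (simp add: norm_subvector sum_ennreal)
  also have "\<dots> = (\<Sum>i\<in>UNIV. ennreal (S $ \<iota> i $ \<iota> i))"
    by (subst nn_integral_sum) (simp_all only: gaussian_second_moment[OF S G], measurable)
  also have "\<dots> = ennreal ((sqrt (\<Sum>i\<in>UNIV. S $ \<iota> i $ \<iota> i))\<^sup>2)"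
    using nn by (simp add: sum_ennreal pos_def_diagonal_nonneg[OF S])
  finally show ?thesis using nn by (simp add: L2_le_def)
qed

text \<open>Minkowski on a near-optimal coupling: the centred vector is a centred Gaussian plus the
  transport displacement. Selecting coordinates along an injective map does not increase norms, so
  the displacement still costs at most \<open>c\<close>.\<close>

lemma W2_gaussian_subvector:
  fixes X :: "'w \<Rightarrow> real^'j" and \<iota> :: "'k::finite \<Rightarrow> 'j"
  assumes M: "prob_space M" and X[measurable]: "X \<in> borel_measurable M" and S: "pos_def S"
    and W: "W2 (distr M borel X) (gaussian \<mu> S) \<le> ennreal c" and c: "0 \<le> c" and \<iota>: "inj \<iota>"
  shows "L2_le M (\<lambda>\<omega>. subvector \<iota> (X \<omega> - \<mu>)) (sqrt (\<Sum>i\<in>UNIV. S $ \<iota> i $ \<iota> i) + c)"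
proof -
  let ?r = "sqrt (\<Sum>i\<in>UNIV. S $ \<iota> i $ \<iota> i)"
  have r: "0 \<le> ?r" by (intro real_sqrt_ge_zero sum_nonneg pos_def_diagonal_nonneg S)
  have "(\<integral>\<^sup>+ \<omega>. ennreal ((norm (subvector \<iota> (X \<omega> - \<mu>)))\<^sup>2) \<partial>M) \<le> ennreal ((?r + c)\<^sup>2)"
  proof (rule le_ennreal_square_of_add_epsilon)
    fix \<delta> :: real assume "0 < \<delta>"
    then obtain \<pi> where \<pi>: "\<pi> \<in> couplings (distr M borel X) (gaussian \<mu> S)"
      and cost: "L2_le \<pi> (\<lambda>z. fst z - snd z) (c + \<delta>)"
      using W2_le_imp_coupling[OF W c] by blast
    have [measurable_cong]: "sets \<pi> = sets (borel \<Otimes>\<^sub>M borel)"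
      and m1: "distr \<pi> borel fst = distr M borel X" and m2: "distr \<pi> borel snd = gaussian \<mu> S"
      using \<pi> by (auto simp: couplings_def)
    have "prob_space \<pi>"
      using couplings_prob_space[OF \<pi>] prob_space.prob_space_distr[OF M X] by auto
    \<comment> \<open>Normalization of the Gaussian density comes for free: it is a marginal of the
      probability measure \<open>\<pi>\<close>.\<close>
    then have "prob_space (gaussian \<mu> S)"
      unfolding m2[symmetric] by (rule prob_space.prob_space_distr) measurable
    from L2_le_subvector_gaussian[OF S this, of \<iota>]
    have "L2_le \<pi> (\<lambda>z. subvector \<iota> (snd z - \<mu>)) ?r"
      unfolding m2[symmetric] by (subst (asm) L2_le_distr) measurable
    then have "L2_le \<pi> (\<lambda>z. subvector \<iota> (fst z - \<mu>)) (?r + (c + \<delta>))"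
      using cost
    proof (rule L2_le_triangle)
      show "AE z in \<pi>. norm (subvector \<iota> (fst z - \<mu>))
          \<le> norm (subvector \<iota> (snd z - \<mu>)) + norm (fst z - snd z)"
      proof (rule AE_I2)
        fix z
        have "subvector \<iota> (fst z - \<mu>) = subvector \<iota> (snd z - \<mu>) + subvector \<iota> (fst z - snd z)"
          by (simp add: subvector_def vec_eq_iff)
        then show "norm (subvector \<iota> (fst z - \<mu>))
          \<le> norm (subvector \<iota> (snd z - \<mu>)) + norm (fst z - snd z)"
          using norm_subvector_le[OF \<iota>, of "fst z - snd z"]
          by (metis (no_types, lifting) add_left_mono norm_triangle_ineq order_trans)
      qed
    qed measurable
    then have "L2_le (distr \<pi> borel fst) (\<lambda>z. subvector \<iota> (z - \<mu>)) (?r + c + \<delta>)"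
      by (subst L2_le_distr) (simp_all add: add.assoc)
    then have "L2_le M (\<lambda>\<omega>. subvector \<iota> (X \<omega> - \<mu>)) (?r + c + \<delta>)"
      unfolding m1 by (subst (asm) L2_le_distr) simp_all
    then show "(\<integral>\<^sup>+ \<omega>. ennreal ((norm (subvector \<iota> (X \<omega> - \<mu>)))\<^sup>2) \<partial>M) \<le> ennreal ((?r + c + \<delta>)\<^sup>2)"
      by (simp add: L2_le_def)
  qed (use r c in simp)
  then show ?thesis using r c by (simp add: L2_le_def)
qed

lemma W2_gaussian_blocks:
  fixes X :: "'w \<Rightarrow> real^'n" and Y :: "'w \<Rightarrow> real^'m"
  assumes M: "prob_space M" and [measurable]: "X \<in> borel_measurable M" "Y \<in> borel_measurable M"
    and A: "pos_def A" and B: "pos_def B" and c: "0 \<le> c"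
    and W: "W2 (distr M borel (\<lambda>\<omega>. stack (X \<omega>) (Y \<omega>))) (gaussian (stack a b) (block_diag A B)) \<le> ennreal c"
  shows "L2_le M (\<lambda>\<omega>. X \<omega> - a) (sqrt (trace A) + c)"
    and "L2_le M (\<lambda>\<omega>. Y \<omega> - b) (sqrt (trace B) + c)"
proof -
  have sub: "subvector Inl (stack p q) = p" "subvector Inr (stack p q) = q" for p :: "real^'n" and q :: "real^'m"
    by (simp_all add: subvector_def stack_def vec_eq_iff)
  have "(\<lambda>\<omega>. stack (X \<omega>) (Y \<omega>)) \<in> borel_measurable M" by measurable
  note * = W2_gaussian_subvector[OF M this pos_def_block_diag[OF A B] W c]
  show "L2_le M (\<lambda>\<omega>. X \<omega> - a) (sqrt (trace A) + c)"
    using *[of Inl] by (simp add: stack_diff sub trace_def block_diag_def block_matrix_def)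
  show "L2_le M (\<lambda>\<omega>. Y \<omega> - b) (sqrt (trace B) + c)"
    using *[of Inr] by (simp add: stack_diff sub trace_def block_diag_def block_matrix_def)
qed

section \<open>Error recursion of the filter\<close>

theorem theorem1:
  fixes M :: "'w measure"
    and f :: "(real^'n) \<times> (real^'p) \<Rightarrow> real^'n"
    and h :: "real^'n \<Rightarrow> real^'m"
    and x w :: "nat \<Rightarrow> 'w \<Rightarrow> real^'n"
    and y v :: "nat \<Rightarrow> 'w \<Rightarrow> real^'m"
    and u :: "nat \<Rightarrow> 'w \<Rightarrow> real^'p"
    and U :: "(real^'p) set"
    and xhat0 :: "real^'n" and what :: "nat \<Rightarrow> real^'n" and vhat :: "nat \<Rightarrow> real^'m"
    and Sx0 :: "real^'n^'n" and Sw :: "nat \<Rightarrow> real^'n^'n" and Sv :: "nat \<Rightarrow> real^'m^'m"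
    and epshat :: "nat \<Rightarrow> real^('n + 'm)" and Seps :: "nat \<Rightarrow> real^('n + 'm)^('n + 'm)"
    and Qhat :: "nat \<Rightarrow> (real^('n + 'm)) measure"
    and xprior xpost eprior epost :: "nat \<Rightarrow> 'w \<Rightarrow> real^'n"
    and A :: "nat \<Rightarrow> 'w \<Rightarrow> real^'n^'n" and C :: "nat \<Rightarrow> 'w \<Rightarrow> real^'n^'m"
    and K :: "nat \<Rightarrow> 'w \<Rightarrow> real^'m^'n"
    and sol :: "nat \<Rightarrow> 'w \<Rightarrow> ('n, 'm) sdp_point"
    and eps eps_eff :: "nat \<Rightarrow> 'w \<Rightarrow> real^('n + 'm)"
    and w_eff :: "nat \<Rightarrow> 'w \<Rightarrow> real^'n" and v_eff :: "nat \<Rightarrow> 'w \<Rightarrow> real^'m"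
    and N :: "(real^'n) set"
    and L\<^sub>f L\<^sub>h \<alpha>\<^sub>f \<alpha>\<^sub>h :: real
    and \<theta> abar mbar kbar :: "nat \<Rightarrow> real"
    and s \<gamma> \<eta>\<^sub>f \<eta>\<^sub>f_prev \<eta>\<^sub>h \<theta>_eff \<rho> \<rho>_prior V :: "nat \<Rightarrow> real"
  assumes \<comment> \<open>system\<close>
    prob: "prob_space M"
    and f_C2: "twice_continuously_differentiable f"
    and h_C2: "twice_continuously_differentiable h"
    and x0_rv: "x 0 \<in> borel_measurable M"
    and w_rv: "\<And>t. w t \<in> borel_measurable M"
    and v_rv: "\<And>t. v t \<in> borel_measurable M"
    and x0_L2: "integrable M (\<lambda>\<omega>. (norm (x 0 \<omega>))\<^sup>2)"
    and w_L2: "\<And>t. integrable M (\<lambda>\<omega>. (norm (w t \<omega>))\<^sup>2)"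
    and v_L2: "\<And>t. integrable M (\<lambda>\<omega>. (norm (v t \<omega>))\<^sup>2)"
    and indep_families: "prob_space.indep_sets M
       (\<lambda>j. [sets (generated_algebra M x {0}),
              sets (generated_algebra M w UNIV),
              sets (generated_algebra M v UNIV)] ! j) {..<3}"
    and indep_w: "prob_space.indep_vars M (\<lambda>_. borel) w UNIV"
    and indep_v: "prob_space.indep_vars M (\<lambda>_. borel) v UNIV"
    and u_adapted: "\<And>t. u t \<in> borel_measurable (generated_algebra M y {..t})"
    and u_admissible: "\<And>t. AE \<omega> in M. u t \<omega> \<in> U"
    and state: "\<And>t \<omega>. \<omega> \<in> space M \<Longrightarrow> x (Suc t) \<omega> = f (x t \<omega>, u t \<omega>) + w t \<omega>"
    and observation: "\<And>t \<omega>. \<omega> \<in> space M \<Longrightarrow> y t \<omega> = h (x t \<omega>) + v t \<omega>"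
    \<comment> \<open>nominal model\<close>
    and Sx0_pos: "pos_def Sx0"
    and Sw_pos: "\<And>t. pos_def (Sw t)"
    and Sv_pos: "\<And>t. pos_def (Sv t)"
    and eps_def: "\<And>t \<omega>. eps t \<omega> = stack (case t of 0 \<Rightarrow> x 0 \<omega> | Suc t' \<Rightarrow> w t' \<omega>) (v t \<omega>)"
    and epshat_def: "\<And>t. epshat t = stack (case t of 0 \<Rightarrow> xhat0 | Suc t' \<Rightarrow> what t') (vhat t)"
    and Seps_def: "\<And>t. Seps t = block_diag (case t of 0 \<Rightarrow> Sx0 | Suc t' \<Rightarrow> Sw t') (Sv t)"
    and Qhat_def: "\<And>t. Qhat t = gaussian (epshat t) (Seps t)"
    \<comment> \<open>filter\<close>
    and xprior_0: "\<And>\<omega>. \<omega> \<in> space M \<Longrightarrow> xprior 0 \<omega> = xhat0"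
    and C_def: "\<And>t \<omega>. \<omega> \<in> space M \<Longrightarrow> C t \<omega> = jacobian h (at (xprior t \<omega>))"
    and xpost_eq: "\<And>t \<omega>. \<omega> \<in> space M \<Longrightarrow>
       xpost t \<omega> = xprior t \<omega> + K t \<omega> *v (y t \<omega> - h (xprior t \<omega>) - vhat t)"
    and A_def: "\<And>t \<omega>. \<omega> \<in> space M \<Longrightarrow>
       A t \<omega> = jacobian (\<lambda>z. f (z, u t \<omega>)) (at (xpost t \<omega>))"
    and xprior_Suc: "\<And>t \<omega>. \<omega> \<in> space M \<Longrightarrow>
       xprior (Suc t) \<omega> = f (xpost t \<omega>, u t \<omega>) + what t"
    and sol_measurable: "\<And>t. sdp_measurable (generated_algebra M y {..<t}) (sol t)"
    and sol_0: "\<And>\<omega>. \<omega> \<in> space M \<Longrightarrow>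
       sdp_optimal (sdp_feasible_init (Seps 0) (C 0 \<omega>) (\<theta>_eff 0)) (sol 0 \<omega>)"
    and sol_Suc: "\<And>t \<omega>. \<omega> \<in> space M \<Longrightarrow>
       sdp_optimal (sdp_feasible_step (A t \<omega>) (post_cov (sol t \<omega>))
         (Seps (Suc t)) (C (Suc t) \<omega>) (\<theta>_eff (Suc t))) (sol (Suc t) \<omega>)"
    and K_def: "\<And>t \<omega>. \<omega> \<in> space M \<Longrightarrow>
       K t \<omega> = sdp_T (C t \<omega>) (sol t \<omega>) ** matrix_inv (sdp_S (C t \<omega>) (sol t \<omega>))"
    \<comment> \<open>errors and effective uncertainty\<close>
    and eprior_def: "\<And>t \<omega>. eprior t \<omega> = x t \<omega> - xprior t \<omega>"
    and epost_def: "\<And>t \<omega>. epost t \<omega> = x t \<omega> - xpost t \<omega>"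
    and w_eff_def: "\<And>t \<omega>. w_eff t \<omega> =
       w t \<omega> + residual (\<lambda>z. f (z, u t \<omega>)) (xpost t \<omega>) (epost t \<omega>)"
    and v_eff_def: "\<And>t \<omega>. v_eff t \<omega> = v t \<omega> + residual h (xprior t \<omega>) (eprior t \<omega>)"
    and eps_eff_def: "\<And>t \<omega>. eps_eff t \<omega> =
       stack (case t of 0 \<Rightarrow> x 0 \<omega> | Suc t' \<Rightarrow> w_eff t' \<omega>) (v_eff t \<omega>)"
    \<comment> \<open>(A1)\<close>
    and L_nonneg: "0 \<le> L\<^sub>f" "0 \<le> L\<^sub>h"
    and N_open: "open N"
    and f_Lipschitz: "\<And>a z z'. a \<in> U \<Longrightarrow> z \<in> N \<Longrightarrow> z' \<in> N \<Longrightarrow>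
       spectral_norm (jacobian (\<lambda>\<xi>. f (\<xi>, a)) (at z) - jacobian (\<lambda>\<xi>. f (\<xi>, a)) (at z'))
         \<le> L\<^sub>f * norm (z - z')"
    and h_Lipschitz: "\<And>z z'. z \<in> N \<Longrightarrow> z' \<in> N \<Longrightarrow>
       spectral_norm (jacobian h (at z) - jacobian h (at z')) \<le> L\<^sub>h * norm (z - z')"
    and segments: "AE \<omega> in M. \<forall>t. closed_segment (xprior t \<omega>) (x t \<omega>) \<subseteq> N \<and>
       closed_segment (xpost t \<omega>) (x t \<omega>) \<subseteq> N"
    \<comment> \<open>(A2)\<close>
    and \<alpha>_nonneg: "0 \<le> \<alpha>\<^sub>f" "0 \<le> \<alpha>\<^sub>h"
    and fourth_moment_prior: "\<And>t. esqrt (\<integral>\<^sup>+ \<omega>. ennreal ((norm (eprior t \<omega>)) ^ 4) \<partial>M)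
       \<le> ennreal \<alpha>\<^sub>h * (\<integral>\<^sup>+ \<omega>. ennreal ((norm (eprior t \<omega>))\<^sup>2) \<partial>M)"
    and fourth_moment_post: "\<And>t. t \<ge> 1 \<Longrightarrow>
       esqrt (\<integral>\<^sup>+ \<omega>. ennreal ((norm (epost (t - 1) \<omega>)) ^ 4) \<partial>M)
       \<le> ennreal \<alpha>\<^sub>f * (\<integral>\<^sup>+ \<omega>. ennreal ((norm (epost (t - 1) \<omega>))\<^sup>2) \<partial>M)"
    \<comment> \<open>(A3)\<close>
    and \<theta>_nonneg: "\<And>t. 0 \<le> \<theta> t"
    and \<theta>_bound: "\<And>t. W2 (distr M borel (eps t)) (Qhat t) \<le> ennreal (\<theta> t)"
    \<comment> \<open>(A4)\<close>
    and A_bound: "\<And>t. AE \<omega> in M. spectral_norm (A t \<omega>) \<le> abar t"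
    and IKC_bound: "\<And>t. AE \<omega> in M. spectral_norm (mat 1 - K t \<omega> ** C t \<omega>) \<le> mbar t"
    and K_bound: "\<And>t. AE \<omega> in M. spectral_norm (K t \<omega>) \<le> kbar t"
    \<comment> \<open>recursions; \<open>\<eta>\<^sub>f_prev t\<close> is the process-residual bound at index \<open>t - 1\<close>\<close>
    and \<rho>_prior_0: "\<rho>_prior 0 = 0"
    and \<eta>\<^sub>f_prev_0: "\<eta>\<^sub>f_prev 0 = 0"
    and \<eta>\<^sub>f_prev_Suc: "\<And>t. \<eta>\<^sub>f_prev (Suc t) = \<eta>\<^sub>f t"
    and s_0: "s 0 = mbar 0 * sqrt (trace Sx0) + kbar 0 * sqrt (trace (Sv 0))
       + (mbar 0 + kbar 0) * \<theta> 0"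
    and \<gamma>_0: "\<gamma> 0 = sqrt (trace Sx0) + \<theta> 0"
    and s_Suc: "\<And>t. s (Suc t) = mbar (Suc t) * (abar t * s t + sqrt (trace (Sw t)))
       + kbar (Suc t) * sqrt (trace (Sv (Suc t))) + (mbar (Suc t) + kbar (Suc t)) * \<theta> (Suc t)"
    and \<gamma>_Suc: "\<And>t. \<gamma> (Suc t) = abar t * V t + sqrt (trace (Sw t)) + \<theta> (Suc t) + \<eta>\<^sub>f t"
    and \<eta>\<^sub>h_def: "\<And>t. \<eta>\<^sub>h t = L\<^sub>h / 2 * \<alpha>\<^sub>h * (\<gamma> t)\<^sup>2"
    and \<theta>_eff_def: "\<And>t. \<theta>_eff t = \<theta> t + sqrt ((\<eta>\<^sub>f_prev t)\<^sup>2 + (\<eta>\<^sub>h t)\<^sup>2)"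
    and \<rho>_def: "\<And>t. \<rho> t = mbar t * \<rho>_prior t + kbar t * \<eta>\<^sub>h t"
    and V_def: "\<And>t. V t = s t + \<rho> t"
    and \<eta>\<^sub>f_def: "\<And>t. \<eta>\<^sub>f t = L\<^sub>f / 2 * \<alpha>\<^sub>f * (V t)\<^sup>2"
    and \<rho>_prior_Suc: "\<And>t. \<rho>_prior (Suc t) = abar t * \<rho> t + \<eta>\<^sub>f t"
  shows "\<forall>t. W2 (distr M borel (eps_eff t)) (Qhat t) \<le> ennreal (\<theta>_eff t) \<and>
     (\<integral>\<^sup>+ \<omega>. ennreal ((norm (eprior t \<omega>))\<^sup>2) \<partial>M) \<le> ennreal ((\<gamma> t)\<^sup>2) \<and>
     (\<integral>\<^sup>+ \<omega>. ennreal ((norm (epost t \<omega>))\<^sup>2) \<partial>M) \<le> ennreal ((V t)\<^sup>2)"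
proof -
  interpret prob_space M by (rule prob)
  define rf where "rf t \<omega> = residual (\<lambda>z. f (z, u t \<omega>)) (xpost t \<omega>) (epost t \<omega>)" for t \<omega>
  define rh where "rh t \<omega> = residual h (xprior t \<omega>) (eprior t \<omega>)" for t \<omega>

  \<comment> \<open>Each bound dominates a nonnegative norm almost surely, and a probability space
    is not null.\<close>
  have nonneg: "0 \<le> abar t" "0 \<le> mbar t" "0 \<le> kbar t" for t
  proof -
    have *: "0 \<le> c" if "AE \<omega> in M. spectral_norm (B \<omega>) \<le> c" for B :: "'w \<Rightarrow> real^'i^'j" and c
    proof -
      have "AE \<omega> in M. 0 \<le> c"
        using that by eventually_elim (rule order_trans[OF spectral_norm_nonneg])
      then show ?thesis by simp
    qed
    show "0 \<le> abar t" by (rule *[OF A_bound])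
    show "0 \<le> mbar t" by (rule *[OF IKC_bound])
    show "0 \<le> kbar t" by (rule *[OF K_bound])
  qed

  \<comment> \<open>Measurability of states, estimates, gains and residuals\<close>
  have h_meas[measurable]: "h \<in> borel_measurable borel"
    by (intro borel_measurable_continuous_onI C2_continuous h_C2)
  have f_meas: "(\<lambda>\<omega>. f (X \<omega>, a \<omega>)) \<in> borel_measurable M"
    if "X \<in> borel_measurable M" "a \<in> borel_measurable M" for X a
    using that borel_measurable_continuous_onI[OF C2_continuous[OF f_C2]]
    by (intro measurable_compose[of "\<lambda>\<omega>. (X \<omega>, a \<omega>)" M borel f borel] borel_measurable_Pair)
  note [measurable] = w_rv v_rv
  have y_meas: "y t \<in> borel_measurable M" if [measurable]: "x t \<in> borel_measurable M" for t
    by (subst measurable_cong[OF observation]) measurable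
  have u_meas: "u t \<in> borel_measurable M" if "\<And>i. i \<le> t \<Longrightarrow> y i \<in> borel_measurable M" for t
    using that by (intro borel_measurable_generated_algebra[OF _ u_adapted]) auto
  have K_meas: "K t \<in> borel_measurable M"
    if y: "\<And>i. i < t \<Longrightarrow> y i \<in> borel_measurable M" and [measurable]: "xprior t \<in> borel_measurable M" for t
  proof -
    have C: "C t \<in> borel_measurable M"
      by (subst measurable_cong[OF C_def]) (auto intro: borel_measurable_jacobian[OF h_C2])
    note [measurable] = C
    have [measurable]: "(\<lambda>\<omega>. prior_cov (sol t \<omega>)) \<in> borel_measurable M"
      "(\<lambda>\<omega>. meas_cov (sol t \<omega>)) \<in> borel_measurable M" "(\<lambda>\<omega>. cross_cov (sol t \<omega>)) \<in> borel_measurable M"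
      using sol_measurable[of t] y unfolding sdp_measurable_def
      by (auto intro: borel_measurable_generated_algebra[of "{..<t}" y])
    show ?thesis
      by (subst measurable_cong[OF K_def]) (simp_all add: sdp_T_def sdp_S_def)
  qed
  have xpost_meas: "xpost t \<in> borel_measurable M"
    if y: "\<And>i. i \<le> t \<Longrightarrow> y i \<in> borel_measurable M" and [measurable]: "xprior t \<in> borel_measurable M" for t
  proof -
    have [measurable]: "K t \<in> borel_measurable M" "y t \<in> borel_measurable M"
      using y by (auto intro: K_meas)
    show ?thesis by (subst measurable_cong[OF xpost_eq]) measurable
  qed
  \<comment> \<open>The invariant stops at observations before \<open>t\<close>: the gain at stage
    \<open>t\<close> depends only on these, while \<open>y t\<close>, needed for the input and the
    posterior estimate, is recovered from \<open>x t\<close>.\<close>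
  have "x t \<in> borel_measurable M \<and> xprior t \<in> borel_measurable M \<and> (\<forall>i<t. y i \<in> borel_measurable M)" for t
  proof (induction t)
    case 0
    have "xprior 0 \<in> borel_measurable M" by (subst measurable_cong[OF xprior_0]) auto
    then show ?case using x0_rv by simp
  next
    case (Suc t)
    then have y: "y i \<in> borel_measurable M" if "i \<le> t" for i
      using y_meas that by (cases "i = t") auto
    have m: "u t \<in> borel_measurable M" "xpost t \<in> borel_measurable M"
      using y Suc u_meas[of t] xpost_meas[of t] by auto
    have "x (Suc t) \<in> borel_measurable M"
      using Suc m w_rv by (subst measurable_cong[OF state]) (auto intro!: borel_measurable_add f_meas)
    moreover have "xprior (Suc t) \<in> borel_measurable M"
      using m by (subst measurable_cong[OF xprior_Suc]) (auto intro!: borel_measurable_add f_meas)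
    ultimately show ?case using y by (simp add: less_Suc_eq_le)
  qed
  then have x_m[measurable]: "x t \<in> borel_measurable M" and xprior_m[measurable]: "xprior t \<in> borel_measurable M"
    and y_m: "y t \<in> borel_measurable M" for t by blast+
  have u_m[measurable]: "u t \<in> borel_measurable M" and xpost_m[measurable]: "xpost t \<in> borel_measurable M" for t
    using u_meas xpost_meas y_m by auto
  have eprior_m[measurable]: "eprior t \<in> borel_measurable M" and epost_m[measurable]: "epost t \<in> borel_measurable M" for t
    unfolding eprior_def[abs_def] epost_def[abs_def] by measurable
  have rh_m[measurable]: "rh t \<in> borel_measurable M" for t
    unfolding rh_def[abs_def] residual_def
    by (intro borel_measurable_diff borel_measurable_matrix_vector_mult borel_measurable_jacobian[OF h_C2]) measurable
  have rf_m[measurable]: "rf t \<in> borel_measurable M" for t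
    unfolding rf_def[abs_def] residual_def
    by (intro borel_measurable_diff borel_measurable_matrix_vector_mult borel_measurable_jacobian_partial[OF f_C2] f_meas) measurable

  \<comment> \<open>Mean-square bounds for the centred noises\<close>
  have eps_eq: "eps 0 = (\<lambda>\<omega>. stack (x 0 \<omega>) (v 0 \<omega>))" "eps (Suc t) = (\<lambda>\<omega>. stack (w t \<omega>) (v (Suc t) \<omega>))" for t
    by (simp_all add: fun_eq_iff eps_def)
  have Qhat_eq: "Qhat 0 = gaussian (stack xhat0 (vhat 0)) (block_diag Sx0 (Sv 0))"
    "Qhat (Suc t) = gaussian (stack (what t) (vhat (Suc t))) (block_diag (Sw t) (Sv (Suc t)))" for t
    by (simp_all add: Qhat_def epshat_def Seps_def)
  note noise_init = W2_gaussian_blocks[OF prob x_m v_rv Sx0_pos Sv_pos \<theta>_nonneg \<theta>_bound[of 0, unfolded eps_eq Qhat_eq]]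
  note noise_step = W2_gaussian_blocks[OF prob w_rv v_rv Sw_pos Sv_pos \<theta>_nonneg \<theta>_bound[of "Suc _", unfolded eps_eq Qhat_eq]]
  have noise_v: "L2_le M (\<lambda>\<omega>. v t \<omega> - vhat t) (sqrt (trace (Sv t)) + \<theta> t)" for t
    by (cases t) (auto intro: noise_init(2) noise_step(2))

  \<comment> \<open>Mean-square bounds for the residuals\<close>
  have rh_bound: "AE \<omega> in M. norm (rh t \<omega>) \<le> L\<^sub>h / 2 * norm ((norm (eprior t \<omega>))\<^sup>2)" for t
    using segments
  proof eventually_elim
    case (elim \<omega>)
    have x: "xprior t \<omega> + eprior t \<omega> = x t \<omega>" by (simp add: eprior_def)
    have "norm (rh t \<omega>) \<le> L\<^sub>h / 2 * (norm (eprior t \<omega>))\<^sup>2"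
      unfolding rh_def
    proof (rule residual_bound[OF C2_differentiable[OF h_C2]])
      fix z assume "z \<in> closed_segment (xprior t \<omega>) (xprior t \<omega> + eprior t \<omega>)"
      then show "spectral_norm (jacobian h (at z) - jacobian h (at (xprior t \<omega>))) \<le> L\<^sub>h * norm (z - xprior t \<omega>)"
        using elim by (intro h_Lipschitz) (auto simp: x)
    qed
    then show ?case by simp
  qed
  have rf_bound: "AE \<omega> in M. norm (rf t \<omega>) \<le> L\<^sub>f / 2 * norm ((norm (epost t \<omega>))\<^sup>2)" for t
    using segments u_admissible[of t]
  proof eventually_elim
    case (elim \<omega>)
    have x: "xpost t \<omega> + epost t \<omega> = x t \<omega>" by (simp add: epost_def)
    have "norm (rf t \<omega>) \<le> L\<^sub>f / 2 * (norm (epost t \<omega>))\<^sup>2"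
      unfolding rf_def
    proof (rule residual_bound[OF differentiable_partial[OF f_C2]])
      fix z assume "z \<in> closed_segment (xpost t \<omega>) (xpost t \<omega> + epost t \<omega>)"
      then show "spectral_norm (jacobian (\<lambda>z. f (z, u t \<omega>)) (at z) - jacobian (\<lambda>z. f (z, u t \<omega>)) (at (xpost t \<omega>)))
          \<le> L\<^sub>f * norm (z - xpost t \<omega>)"
        using elim by (intro f_Lipschitz) (auto simp: x)
    qed
    then show ?case by simp
  qed
  have rh_L2: "L2_le M (rh t) (\<eta>\<^sub>h t)" if "L2_le M (eprior t) (\<gamma> t)" for t
    using L2_le_scale[OF L2_le_square_of_fourth_moment[OF that \<alpha>_nonneg(2) fourth_moment_prior] rh_m _ rh_bound]
      L_nonneg by (simp add: \<eta>\<^sub>h_def mult.assoc)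
  \<comment> \<open>The posterior half of (A2) is indexed by \<open>t - 1\<close> for
    \<open>t \<ge> 1\<close>; its instance at \<open>Suc t\<close> covers every stage.\<close>
  have rf_L2: "L2_le M (rf t) (\<eta>\<^sub>f t)" if "L2_le M (epost t) (V t)" for t
    using L2_le_scale[OF L2_le_square_of_fourth_moment[OF that \<alpha>_nonneg(1)] rf_m _ rf_bound]
      fourth_moment_post[of "Suc t"] L_nonneg by (simp add: \<eta>\<^sub>f_def mult.assoc)

  \<comment> \<open>Alternating induction on the error moments\<close>
  have epost_L2: "L2_le M (epost t) (V t)" if e: "L2_le M (eprior t) (\<gamma> t)" for t
  proof -
    have "L2_le M (epost t) (mbar t * \<gamma> t + kbar t * (sqrt (trace (Sv t)) + \<theta> t) + kbar t * \<eta>\<^sub>h t)"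
      using e noise_v rh_L2[OF e] epost_m nonneg(2,3,3)
    proof (rule L2_le_triangle3)
      show "AE \<omega> in M. norm (epost t \<omega>)
          \<le> mbar t * norm (eprior t \<omega>) + kbar t * norm (v t \<omega> - vhat t) + kbar t * norm (rh t \<omega>)"
        \<comment> \<open>\<open>AE_space\<close> is added because the system and filter equations
          are given on \<open>space M\<close> only.\<close>
        using IKC_bound[of t] K_bound[of t] AE_space
      proof eventually_elim
        case (elim \<omega>)
        let ?K = "K t \<omega>" and ?C = "C t \<omega>" and ?e = "eprior t \<omega>"
        have innovation: "y t \<omega> - h (xprior t \<omega>) - vhat t = ?C *v ?e + (v t \<omega> - vhat t) + rh t \<omega>"
          using elim by (simp add: observation rh_def residual_def C_def eprior_def)
        have "epost t \<omega> = ?e - ?K *v (y t \<omega> - h (xprior t \<omega>) - vhat t)"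
          using elim by (simp add: epost_def xpost_eq eprior_def)
        also note innovation
        also have "?e - ?K *v (?C *v ?e + (v t \<omega> - vhat t) + rh t \<omega>) = (mat 1 - ?K ** ?C) *v ?e - ?K *v (v t \<omega> - vhat t) - ?K *v rh t \<omega>"
          by (simp add: matrix_vector_mult_diff_rdistrib matrix_vector_right_distrib matrix_vector_mul_assoc)
        also have "norm \<dots> \<le> norm ((mat 1 - ?K ** ?C) *v ?e) + norm (?K *v (v t \<omega> - vhat t)) + norm (?K *v rh t \<omega>)"
          by (intro order_trans[OF norm_triangle_ineq4] add_mono order_refl)
        also have "\<dots> \<le> mbar t * norm ?e + kbar t * norm (v t \<omega> - vhat t) + kbar t * norm (rh t \<omega>)"
          using elim by (intro add_mono order_trans[OF norm_matrix_vector_le_spectral_norm] mult_right_mono) auto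
        finally show ?case .
      qed
    qed
    \<comment> \<open>Splitting \<open>\<gamma> t\<close> into its noise part and
      \<open>\<rho>_prior t\<close> recovers \<open>s t\<close> and \<open>\<rho> t\<close>
      separately.\<close>
    moreover have "mbar t * \<gamma> t + kbar t * (sqrt (trace (Sv t)) + \<theta> t) + kbar t * \<eta>\<^sub>h t = V t"
      by (cases t) (simp_all add: V_def \<rho>_def \<rho>_prior_0 \<rho>_prior_Suc s_0 s_Suc \<gamma>_0 \<gamma>_Suc algebra_simps)
    ultimately show ?thesis by simp
  qed
  have eprior_L2_Suc: "L2_le M (eprior (Suc t)) (\<gamma> (Suc t))" if e: "L2_le M (epost t) (V t)" for t
  proof -
    have "L2_le M (eprior (Suc t)) (abar t * V t + 1 * (sqrt (trace (Sw t)) + \<theta> (Suc t)) + 1 * \<eta>\<^sub>f t)"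
      using e noise_step(1) rf_L2[OF e] eprior_m nonneg(1) zero_le_one zero_le_one
    proof (rule L2_le_triangle3)
      show "AE \<omega> in M. norm (eprior (Suc t) \<omega>)
          \<le> abar t * norm (epost t \<omega>) + 1 * norm (w t \<omega> - what t) + 1 * norm (rf t \<omega>)"
        using A_bound[of t] AE_space
      proof eventually_elim
        case (elim \<omega>)
        have "eprior (Suc t) \<omega> = A t \<omega> *v epost t \<omega> + (w t \<omega> - what t) + rf t \<omega>"
          using elim by (simp add: eprior_def state xprior_Suc rf_def residual_def A_def epost_def)
        also have "norm \<dots> \<le> norm (A t \<omega> *v epost t \<omega>) + norm (w t \<omega> - what t) + norm (rf t \<omega>)"
          by (intro order_trans[OF norm_triangle_ineq] add_mono order_refl)
        also have "norm (A t \<omega> *v epost t \<omega>) \<le> abar t * norm (epost t \<omega>)"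
          using elim by (intro order_trans[OF norm_matrix_vector_le_spectral_norm] mult_right_mono) auto
        finally show ?case by simp
      qed
    qed
    then show ?thesis by (simp add: \<gamma>_Suc add.assoc)
  qed
  have eprior_L2: "L2_le M (eprior t) (\<gamma> t)" for t
  proof (induction t)
    case 0
    show ?case
      \<comment> \<open>The initial prior error is the centred first noise block, so the base case
        is a noise bound.\<close>
      by (rule L2_le_scale[OF noise_init(1) eprior_m zero_le_one, unfolded mult_1 \<gamma>_0[symmetric]])
        (auto simp: eprior_def xprior_0)
  next
    case (Suc t)
    then show ?case by (intro eprior_L2_Suc epost_L2)
  qed
  note epost_L2 = epost_L2[OF eprior_L2]

  \<comment> \<open>Wasserstein bound for the effective uncertainty\<close>
  have W: "W2 (distr M borel (eps_eff t)) (Qhat t) \<le> ennreal (\<theta>_eff t)" for t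
  proof -
    \<comment> \<open>The first block carries the process residual of the previous stage. At stage 0
      that block is the initial state, which has no linearization residual, in agreement with
      \<open>\<eta>\<^sub>f_prev 0 = 0\<close>.\<close>
    define r where "r \<omega> = (case t of 0 \<Rightarrow> 0 | Suc t' \<Rightarrow> rf t' \<omega>)" for \<omega>
    have "L2_le M r (\<eta>\<^sub>f_prev t)"
    proof (cases t)
      case 0
      then show ?thesis by (simp add: r_def[abs_def] L2_le_def \<eta>\<^sub>f_prev_0)
    next
      case (Suc t')
      then have "r = rf t'" by (simp add: r_def fun_eq_iff)
      then show ?thesis using rf_L2[OF epost_L2] Suc by (simp add: \<eta>\<^sub>f_prev_Suc)
    qed
    then have L: "L2_le M (\<lambda>\<omega>. stack (r \<omega>) (rh t \<omega>)) (sqrt ((\<eta>\<^sub>f_prev t)\<^sup>2 + (\<eta>\<^sub>h t)\<^sup>2))"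
      by (rule L2_le_stack) (rule rh_L2[OF eprior_L2])
    have eff: "eps_eff t \<omega> = eps t \<omega> + stack (r \<omega>) (rh t \<omega>)" for \<omega>
      by (auto simp: eps_eff_def eps_def r_def w_eff_def v_eff_def rf_def rh_def vec_eq_iff stack_def
          split: sum.split nat.split)
    have eps_m: "eps t \<in> borel_measurable M" by (cases t) (simp_all add: eps_eq)
    have eff_m: "eps_eff t \<in> borel_measurable M"
      unfolding eff[abs_def] using eps_m L by (intro borel_measurable_add) (auto simp: L2_le_def)
    have "W2 (distr M borel (eps_eff t)) (Qhat t) \<le> ennreal (\<theta> t + sqrt ((\<eta>\<^sub>f_prev t)\<^sup>2 + (\<eta>\<^sub>h t)\<^sup>2))"
      using L by (intro W2_perturb[OF prob eps_m eff_m \<theta>_bound \<theta>_nonneg]) (simp add: eff)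
    then show ?thesis by (simp add: \<theta>_eff_def)
  qed
  show ?thesis using W eprior_L2 epost_L2 by (auto simp: L2_le_def)
qed

end
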